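(* Let $K$ be a sufficiently large (fixed) positive constant, let $\delta>0$ be suitably small, let $N^{1/2+\delta}\le Q\le N$, and let $Q_0$ be a real number such that $$K\sqrt{N\log N}\le Q\le N\quad\text{and}\quad \frac{N\log N}{Q}\le Q_0\le \frac{Q}{K^2}.$$ Let $\mathfrak{m}=\mathfrak{m}(K,Q_0,Q)$ be the corresponding set of minor arcs. Suppose $KQ_0<N^{1/2-\delta/2}$. If $N$ is sufficiently large in terms of $\delta$, we have $$\int_{\mathfrak{m}}|\mathcal{S}_{\varpi}(\theta)|^2\,d\theta\gg_\delta Q(\log\log N)^2+N\log\left(\frac{\log N}{\log(2N/Q)}\right),$$ both for $\varpi=\omega$ and for $\varpi=\Omega$.
   Context: The major arcs $\mathfrak{M}=\mathfrak{M}(K,Q_0,Q)$ consist of those $\theta\in\mathbb{R}/\mathbb{Z}$ for which there are a positive integer $q\le KQ_0$ and a reduced residue class $a$ modulo $q$ (i.e. $(a,q)=1$) with $|\theta-a/q|\le K/(qQ)$. The minor arcs $\mathfrak{m}=\mathfrak{m}(K,Q_0,Q)$ are the complement of $\mathfrak{M}$ in $\mathbb{R}/\mathbb{Z}$. For an arithmetic function $f$, $\mathcal{S}_f(\theta):=\sum_{n\le N}f(n)e(n\theta)$ with $e(t)=e^{2\pi i t}$. $\omega(n)$ and $\Omega(n)$ denote the number of prime divisors of $n$ counted without and with multiplicity, respectively; $\varpi$ denotes either one. $A\gg_\delta B$ means $A\ge \kappa B$ for a constant $\kappa>0$ depending on $\delta$ (and possibly on the fixed constant $K$). *)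

theory Defs
  imports "HOL-Analysis.Analysis" "HOL-Computational_Algebra.Computational_Algebra"
begin

definition omega :: "nat \<Rightarrow> nat" where
  "omega n = card (prime_factors n)"

definition Omega :: "nat \<Rightarrow> nat" where
  "Omega n = size (prime_factorization n)"

definition exp_sum :: "(nat \<Rightarrow> complex) \<Rightarrow> nat \<Rightarrow> real \<Rightarrow> complex" where
  "exp_sum f N \<theta> = (\<Sum>n = 1..N. f n * exp (2 * of_real pi * \<i> * of_nat n * of_real \<theta>))"

(* Subsets of R/Z are represented by their 1-periodic preimages in the reals.
   Since a ranges over all integers coprime to q, and not over one representative of each
   reduced residue class, the real absolute value below expresses the distance in R/Z. *)
definition major_arcs :: "real \<Rightarrow> real \<Rightarrow> real \<Rightarrow> real set" where
  "major_arcs K Q0 Q =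
     {\<theta>. \<exists>q::nat. \<exists>a::int. q > 0 \<and> real q \<le> K * Q0 \<and> coprime a (int q) \<and>
          \<bar>\<theta> - of_int a / real q\<bar> \<le> K / (real q * Q)}"

definition minor_arcs :: "real \<Rightarrow> real \<Rightarrow> real \<Rightarrow> real set" where
  "minor_arcs K Q0 Q = - major_arcs K Q0 Q"

(* [0,1) is a fundamental domain for R/Z, so this is the integral over the minor arcs in R/Z. *)
definition minor_arc_integral ::
    "(nat \<Rightarrow> complex) \<Rightarrow> nat \<Rightarrow> real \<Rightarrow> real \<Rightarrow> real \<Rightarrow> real" where
  "minor_arc_integral f N K Q0 Q =
     (LINT \<theta>:minor_arcs K Q0 Q \<inter> {0..<1}|lborel. (cmod (exp_sum f N \<theta>))\<^sup>2)"

end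

theory Submission
  imports Defs "HOL-Number_Theory.Prime_Powers" "HOL-Real_Asymp.Real_Asymp"
begin

text \<open>
  Since \<open>K Q0 < N^(1/2 - \<delta>/2)\<close>, all major arcs other than the one of \<open>a/q\<close> itself stay at a distance of order
  \<open>1/(q N^(1/2 - \<delta>/2))\<close> from a fraction \<open>a/q\<close> with \<open>q\<close> slightly smaller than \<open>sqrt N\<close>. So the minor arcs contain
  an explicit annulus around \<open>a/q\<close>, and it suffices to bound the exponential sum \<open>S\<close> from below there by
  testing it against explicit functions.

  On \<open>[\<eta>, 3\<eta>]\<close> with \<open>\<eta> = 2K/Q\<close>, pairing \<open>S(\<theta>)\<close> with \<open>e(N\<theta>)\<close> times a bump gives a sum of \<open>\<omega>(n)\<close> concentrated on
  \<open>N - n\<close> of order \<open>1/\<eta>\<close>. Primes up to \<open>sqrt N\<close> contribute a multiple of \<open>log log N\<close>, and each \<open>n \<le> N\<close> has at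
  most one larger prime factor, so the rest is trivially of smaller order. This gives the term \<open>Q (log log N)\<^sup>2\<close>.

  For a prime \<open>p\<close> with \<open>100 K N/Q < p \<le> N^(1/2 - \<delta>/4)\<close> and \<open>t\<close> about \<open>1/N\<close>, the sum of \<open>S(a/p + t)\<close> over \<open>0 < a < p\<close>
  has as real part the sum of \<open>\<omega>(n) (p [p dvd n] - 1) cos(2\<pi>nt)\<close>. The prime \<open>p\<close> itself contributes almost \<open>N\<close>,
  the other primes up to \<open>N/p\<close> almost nothing, and those beyond at least about \<open>-(log 2) N\<close>. Hence the arcs
  around the \<open>a/p\<close> contribute at least a constant times \<open>N/p\<close>, and the sum of \<open>1/p\<close> over these \<open>p\<close> is of order
  \<open>log (log N / log (2N/Q))\<close>. Mertens' first theorem suffices for all sums over primes.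
\<close>

subsection \<open>Primes and prime powers\<close>

text \<open>\<open>Omega\<close> counts the prime powers dividing n, \<open>omega\<close> only the
  primes, so these are the divisors in which the two functions differ. They are treated as an error
  term, which lets one argument serve both.\<close>

definition proper_primepows :: "nat set" where
  "proper_primepows = {d. primepow d \<and> \<not> prime d}"

text \<open>The exponent is at least 2: an even one gives a square times 1, an odd one is 3 plus an
  even number. Sums over proper prime powers are thereby dominated by double sums over
  \<open>a\<close> and \<open>b\<close>.\<close>

lemma proper_primepow_form:
  assumes "d \<in> proper_primepows"
  obtains a b :: nat where "a \<ge> 1" "b \<ge> 1" "d = a ^ 2 * b ^ 3"
proof -
  from assms obtain p k where pk: "prime p" "k > 0" "d = p ^ k" and "\<not> prime d"
    by (auto simp: proper_primepows_def primepow_def)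
  hence "k \<noteq> 1" by auto
  note pk = pk this
  have p: "p \<ge> 1" using pk(1) prime_ge_1_nat by blast
  show ?thesis
  proof (cases "even k")
    case True
    then obtain m where "k = 2 * m" by blast
    hence "d = (p ^ m) ^ 2 * 1 ^ 3" using pk by (simp add: power_mult mult.commute)
    with that p show ?thesis by (metis le_numeral_extra(4) one_le_power)
  next
    case False
    then obtain m where m: "k = 2 * m + 1" by (rule oddE)
    with pk have "m \<ge> 1" by simp
    with m have "k = 2 * (m - 1) + 3" by simp
    hence "d = (p ^ (m - 1)) ^ 2 * p ^ 3" using pk
      by (simp add: power_add power_mult[symmetric] mult.commute)
    with that[of "p ^ (m - 1)" p] p show ?thesis by simp
  qed
qed

text \<open>For fixed \<open>b\<close> there are at most sqrt(N) b^(-3/2) values of \<open>a\<close>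
  with a^2 b^3 \<le> N, and the sum of b^(-3/2) converges.\<close>

lemma card_proper_primepows_le:
  obtains C :: real where "C > 0"
    "\<And>N. real (card {d \<in> proper_primepows. d \<le> N}) \<le> C * sqrt (real N)"
proof -
  define C where "C = (\<Sum>b. real b powr (-3/2))"
  have sm: "summable (\<lambda>b. real b powr (-3/2))"
    by (subst summable_real_powr_iff) auto
  have C0: "C \<ge> 0" unfolding C_def by (intro suminf_nonneg sm) auto
  have "real (card {d \<in> proper_primepows. d \<le> N}) \<le> (C + 1) * sqrt (real N)" for N
  proof -
    define A where "A b = nat \<lfloor>sqrt (real N) * real b powr (-3/2)\<rfloor>" for b
    have sub: "{d \<in> proper_primepows. d \<le> N} \<subseteq> (\<Union>b\<in>{1..N}. (\<lambda>a. a ^ 2 * b ^ 3) ` {1..A b})"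
    proof safe
      fix d assume d: "d \<in> proper_primepows" "d \<le> N"
      from proper_primepow_form[OF d(1)] obtain a b :: nat
        where ab: "a \<ge> 1" "b \<ge> 1" "d = a ^ 2 * b ^ 3" by blast
      have "b \<le> b ^ 3 * a ^ 2" using ab
        by (metis One_nat_def Suc_le_eq dual_order.trans le_refl mult_le_mono nat_mult_1_right
            nat_zero_less_power_iff one_le_power power_increasing power_one_right numeral_3_eq_3 le_SucI)
      hence bN: "b \<le> N" using ab d by (simp add: mult.commute)
      have "real a ^ 2 * real b ^ 3 \<le> real N"
        using ab d by (metis of_nat_le_iff of_nat_mult of_nat_power)
      hence "real a ^ 2 \<le> real N * (real b powr (-3/2)) ^ 2"
        using ab by (simp add: powr_power powr_minus powr_numeral field_simps)
      hence "sqrt (real a ^ 2) \<le> sqrt (real N * (real b powr (-3/2)) ^ 2)"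
        by (rule real_sqrt_le_mono)
      hence "real a \<le> sqrt (real N) * real b powr (-3/2)"
        by (simp add: real_sqrt_mult)
      hence "a \<le> A b" unfolding A_def by (simp add: le_nat_floor)
      thus "d \<in> (\<Union>b\<in>{1..N}. (\<lambda>a. a ^ 2 * b ^ 3) ` {1..A b})"
        using ab bN by (intro UN_I[of b] image_eqI[of _ _ a]) auto
    qed
    have "card {d \<in> proper_primepows. d \<le> N} \<le> card (\<Union>b\<in>{1..N}. (\<lambda>a. a ^ 2 * b ^ 3) ` {1..A b})"
      by (rule card_mono[OF _ sub]) auto
    also have "\<dots> \<le> (\<Sum>b\<in>{1..N}. card ((\<lambda>a. a ^ 2 * b ^ 3) ` {1..A b}))"
      by (rule card_UN_le) auto
    also have "\<dots> \<le> (\<Sum>b\<in>{1..N}. A b)"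
      by (intro sum_mono order.trans[OF card_image_le]) auto
    finally have "real (card {d \<in> proper_primepows. d \<le> N}) \<le> (\<Sum>b\<in>{1..N}. real (A b))"
      by (metis of_nat_le_iff of_nat_sum)
    also have "\<dots> \<le> (\<Sum>b\<in>{1..N}. sqrt (real N) * real b powr (-3/2))"
      by (intro sum_mono) (auto simp: A_def)
    also have "\<dots> = sqrt (real N) * (\<Sum>b\<in>{1..N}. real b powr (-3/2))"
      by (simp add: sum_distrib_left)
    also have "\<dots> \<le> sqrt (real N) * C"
      unfolding C_def by (intro mult_left_mono sum_le_suminf sm) auto
    also have "\<dots> \<le> (C + 1) * sqrt (real N)"
      by (simp add: algebra_simps)
    finally show ?thesis .
  qed
  with that[of "C + 1"] C0 show ?thesis by simp
qed

text \<open>Under d = a^2 b^3 the weight becomes a^(-3/2) b^(-9/4), and both series converge. An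
  exponent 3/4 instead of 1 leaves a factor d^(1/4) to absorb a logarithm in the proof of Mertens'
  theorem.\<close>

lemma sum_proper_primepows_le:
  obtains C :: real where "C > 0"
    "\<And>N. (\<Sum>d | d \<in> proper_primepows \<and> d \<le> N. real d powr (-3/4)) \<le> C"
proof -
  define C1 where "C1 = (\<Sum>b. real b powr (-3/2))"
  define C2 where "C2 = (\<Sum>b. real b powr (-9/4))"
  have sm: "summable (\<lambda>b. real b powr (-3/2))" "summable (\<lambda>b. real b powr (-9/4))"
    by (subst summable_real_powr_iff; simp)+
  have C0: "C1 \<ge> 0" "C2 \<ge> 0" unfolding C1_def C2_def by (intro suminf_nonneg sm; simp)+
  have "(\<Sum>d | d \<in> proper_primepows \<and> d \<le> N. real d powr (-3/4)) \<le> C1 * C2 + 1" for N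
  proof -
    have "(\<Sum>d | d \<in> proper_primepows \<and> d \<le> N. real d powr (-3/4))
        \<le> (\<Sum>(a,b)\<in>{1..N}\<times>{1..N}. real a powr (-3/2) * real b powr (-9/4))"
    proof (rule sum_le_included[where i = "\<lambda>(a,b). a ^ 2 * b ^ 3"])
      show "\<forall>d\<in>{d \<in> proper_primepows. d \<le> N}. \<exists>ab\<in>{1..N} \<times> {1..N}.
          (case ab of (a, b) \<Rightarrow> a\<^sup>2 * b ^ 3) = d \<and>
          real d powr (- 3 / 4) \<le> (case ab of (a, b) \<Rightarrow> real a powr (-3/2) * real b powr (-9/4))"
      proof safe
        fix d assume d: "d \<in> proper_primepows" "d \<le> N"
        from proper_primepow_form[OF d(1)] obtain a b :: nat
          where ab: "a \<ge> 1" "b \<ge> 1" "d = a ^ 2 * b ^ 3" by blast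
        have "a dvd d" "b dvd d" "d > 0" using ab by auto
        hence "a \<le> N" "b \<le> N" using d by (auto dest!: dvd_imp_le)
        moreover have "real d powr (-3/4) = real a powr (-3/2) * real b powr (-9/4)"
          using ab by (simp add: powr_mult powr_powr flip: powr_numeral)
        ultimately show "\<exists>ab\<in>{1..N} \<times> {1..N}.
          (case ab of (a, b) \<Rightarrow> a\<^sup>2 * b ^ 3) = d \<and>
          real d powr (- 3 / 4) \<le> (case ab of (a, b) \<Rightarrow> real a powr (-3/2) * real b powr (-9/4))"
          using ab by (intro bexI[of _ "(a,b)"]) auto
      qed
    qed auto
    also have "\<dots> = (\<Sum>a\<in>{1..N}. real a powr (-3/2)) * (\<Sum>b\<in>{1..N}. real b powr (-9/4))"
      by (simp add: sum_product sum.cartesian_product)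
    also have "\<dots> \<le> C1 * C2"
      unfolding C1_def C2_def by (intro mult_mono sum_le_suminf sm sum_nonneg suminf_nonneg) auto
    finally show ?thesis by simp
  qed
  moreover have "C1 * C2 + 1 > 0" using C0 by (simp add: add_nonneg_pos)
  ultimately show ?thesis using that by blast
qed

section \<open>Chebyshev's bound and Mertens' first theorem\<close>

definition primes_upto :: "real \<Rightarrow> nat set" where
  "primes_upto x = {p. prime p \<and> real p \<le> x}"

lemma finite_primes_upto [simp]: "finite (primes_upto x)"
  by (rule finite_subset[of _ "{..nat \<lfloor>x\<rfloor>}"]) (auto simp: primes_upto_def le_nat_floor)

lemma primes_upto_floor:
  assumes "x \<ge> 0"
  shows "primes_upto (real (nat \<lfloor>x\<rfloor>)) = primes_upto x"
proof -
  have "p \<le> nat \<lfloor>x\<rfloor> \<longleftrightarrow> real p \<le> x" for p :: nat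
    using assms by (simp add: le_nat_iff le_floor_iff)
  thus ?thesis by (simp add: primes_upto_def)
qed

lemma prod_primes_dvd:
  fixes m :: nat
  assumes "finite P" "\<And>p. p \<in> P \<Longrightarrow> prime p \<and> p dvd m"
  shows "\<Prod>P dvd m"
  using assms
proof (induction P rule: finite_induct)
  case (insert p P)
  have "coprime p (\<Prod>P)"
    using insert by (intro prod_coprime_right) (metis insertCI primes_coprime)
  thus ?case using insert by (simp add: divides_mult)
qed simp

text \<open>\<open>n - n div 2\<close> is the larger of the two halves of n, so p divides n! but
  neither factorial in the denominator.\<close>

lemma prime_dvd_binomial_middle:
  assumes "prime p" "n - n div 2 < p" "p \<le> n"
  shows "p dvd (n choose (n div 2))"
proof -
  have "fact n = fact (n div 2) * fact (n - n div 2) * (n choose (n div 2))"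
    by (rule binomial_fact_lemma[symmetric]) simp
  moreover have "p dvd fact n" using assms by (simp add: prime_dvd_fact_iff)
  moreover have "\<not> p dvd fact (n div 2)" "\<not> p dvd fact (n - n div 2)"
    using assms by (auto simp: prime_dvd_fact_iff)
  ultimately show ?thesis using assms(1) by (metis prime_dvd_mult_iff)
qed

text \<open>Chebyshev's bound by halving: the primes above \<open>h\<close>, about n/2, have a
  product dividing a middle binomial coefficient, which is at most 2^n; strong induction handles
  those up to \<open>h\<close>.\<close>

lemma sum_ln_primes_le: "(\<Sum>p\<in>primes_upto (real n). ln (real p)) \<le> 3 * real n"
proof (induction n rule: less_induct)
  case (less n)
  show ?case
  proof (cases "n < 2")
    case True
    hence "primes_upto (real n) = {}" by (auto simp: primes_upto_def dest: prime_ge_2_nat)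
    thus ?thesis by simp
  next
    case False
    define h where "h = n - n div 2"
    have h: "h < n" "2 * h \<le> n + 1" using False unfolding h_def by auto
    define P where "P = {p. prime p \<and> h < p \<and> p \<le> n}"
    have finP: "finite P" by (rule finite_subset[of _ "{..n}"]) (auto simp: P_def)
    have split: "primes_upto (real n) = primes_upto (real h) \<union> P"
      using h by (auto simp: primes_upto_def P_def)
    have "\<Prod>P dvd (n choose (n div 2))"
      by (rule prod_primes_dvd[OF finP]) (auto simp: P_def h_def prime_dvd_binomial_middle)
    hence "\<Prod>P \<le> n choose (n div 2)" by (rule dvd_imp_le) simp
    also have "\<dots> \<le> 2 ^ n" by (rule binomial_le_pow2)
    finally have "real (\<Prod>P) \<le> 2 ^ n"
      by (metis of_nat_le_iff of_nat_numeral of_nat_power)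
    hence le: "(\<Prod>p\<in>P. real p) \<le> 2 ^ n" by simp
    have pos: "(\<Prod>p\<in>P. real p) > 0" by (rule prod_pos) (auto simp: P_def prime_gt_0_nat)
    have "(\<Sum>p\<in>P. ln (real p)) = ln (\<Prod>p\<in>P. real p)"
      by (rule ln_prod[symmetric]) (auto simp: finP P_def prime_gt_0_nat)
    also have "\<dots> \<le> ln (2 ^ n)" using le pos by simp
    also have "\<dots> = real n * ln 2" by (simp add: ln_realpow)
    also have "\<dots> \<le> real n * (25 / 36)" by (intro mult_left_mono ln2_le_25_over_36) simp
    finally have 1: "(\<Sum>p\<in>P. ln (real p)) \<le> real n * (25 / 36)" .
    have "(\<Sum>p\<in>primes_upto (real n). ln (real p))
        = (\<Sum>p\<in>primes_upto (real h). ln (real p)) + (\<Sum>p\<in>P. ln (real p))"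
      unfolding split by (rule sum.union_disjoint) (auto simp: finP P_def primes_upto_def)
    also have "\<dots> \<le> 3 * real h + real n * (25 / 36)"
      using less.IH[OF h(1)] 1 by simp
    \<comment> \<open>With h \<le> (n + 1)/2 this needs (29/36) n \<ge> 3/2, true from n = 2 on;
      hence the separate case of smaller n.\<close>
    also have "\<dots> \<le> 3 * real n"
    proof -
      have "2 * real h \<le> real n + 1" using h(2) by linarith
      moreover have "real n \<ge> 2" using False by simp
      ultimately show ?thesis by linarith
    qed
    finally show ?thesis .
  qed
qed

lemma sum_multiples:
  fixes d n :: nat
  assumes "d \<ge> 1"
  shows "(\<Sum>m | m \<in> {1..n} \<and> d dvd m. g m) = (\<Sum>j=1..n div d. g (d * j))"
proof (rule sum.reindex_bij_witness[of _ "\<lambda>j. d * j" "\<lambda>m. m div d"])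
  fix m assume "m \<in> {m. m \<in> {1..n} \<and> d dvd m}"
  hence m: "1 \<le> m" "m \<le> n" "d dvd m" by auto
  hence "d \<le> m" by (auto intro: dvd_imp_le)
  hence "1 \<le> m div d" using assms by (simp add: Suc_le_eq div_greater_zero_iff)
  thus "m div d \<in> {1..n div d}" using m by (simp add: div_le_mono)
next
  fix j assume j: "j \<in> {1..n div d}"
  hence "d * j \<le> d * (n div d)" by simp
  also have "\<dots> \<le> n" by simp
  finally show "d * j \<in> {m. m \<in> {1..n} \<and> d dvd m}" using j assms by auto
qed (use assms in auto)

text \<open>ln m is the sum of \<open>mangoldt\<close> over the divisors of m; after summing over m
  and interchanging, \<open>n div d\<close> counts the multiples of d.\<close>

lemma ln_fact_mangoldt:
  "ln (fact n :: real) = (\<Sum>d=1..n. mangoldt d * real (n div d))"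
proof -
  have "ln (fact n :: real) = (\<Sum>m=1..n. ln (real m))"
    unfolding fact_prod of_nat_prod by (rule ln_prod) auto
  also have "\<dots> = (\<Sum>m=1..n. \<Sum>d | d \<in> {1..n} \<and> d dvd m. mangoldt d)"
  proof (rule sum.cong[OF refl])
    fix m assume m: "m \<in> {1..n}"
    have "ln (real m) = (\<Sum>d | d dvd m. mangoldt d)"
      using mangoldt_sum[of m, where 'a = real] m by simp
    also have "{d. d dvd m} = {d. d \<in> {1..n} \<and> d dvd m}"
      using m by (auto dest: dvd_imp_le intro: Nat.gr0I)
    finally show "ln (real m) = (\<Sum>d | d \<in> {1..n} \<and> d dvd m. mangoldt d)" .
  qed
  also have "\<dots> = (\<Sum>d=1..n. \<Sum>m | m \<in> {1..n} \<and> d dvd m. mangoldt d)"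
    by (rule sum.swap_restrict) auto
  also have "\<dots> = (\<Sum>d=1..n. mangoldt d * real (n div d))"
  proof (rule sum.cong[OF refl])
    fix d assume d: "d \<in> {1..n}"
    hence "(\<Sum>m | m \<in> {1..n} \<and> d dvd m. mangoldt d) = (\<Sum>j=1..n div d. mangoldt d :: real)"
      by (intro sum_multiples) simp
    thus "(\<Sum>m | m \<in> {1..n} \<and> d dvd m. mangoldt d) = mangoldt d * real (n div d)"
      by simp
  qed
  finally show ?thesis .
qed

lemma ln_fact_le: "n \<ge> 1 \<Longrightarrow> ln (fact n :: real) \<le> real n * ln (real n)"
proof -
  assume n: "n \<ge> 1"
  have "ln (fact n :: real) \<le> ln (real n ^ n)"
    using n fact_le_power[of n, where 'a = real] by (subst ln_le_cancel_iff) auto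
  thus ?thesis using n by (simp add: ln_realpow)
qed

text \<open>n^n / n! is a single term of the series for exp n.\<close>

lemma ln_fact_ge: "n \<ge> 1 \<Longrightarrow> ln (fact n :: real) \<ge> real n * ln (real n) - real n"
proof -
  assume n: "n \<ge> 1"
  have "real n ^ n / fact n = (\<Sum>k\<in>{n}. real n ^ k /\<^sub>R fact k)" by (simp add: field_simps)
  also have "\<dots> \<le> (\<Sum>k. real n ^ k /\<^sub>R fact k)"
    using summable_exp_generic[of "real n"] by (intro sum_le_suminf) auto
  also have "\<dots> = exp (real n)" by (simp add: exp_def)
  finally have "ln (real n ^ n / fact n) \<le> ln (exp (real n))"
    using n by (subst ln_le_cancel_iff) auto
  thus ?thesis using n by (simp add: ln_div ln_realpow)
qed

lemma sum_mangoldt_split: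
  fixes g :: "nat \<Rightarrow> real"
  shows "(\<Sum>d=1..n. mangoldt d * g d) = (\<Sum>p\<in>primes_upto (real n). ln (real p) * g p)
    + (\<Sum>d | d \<in> proper_primepows \<and> d \<le> n. mangoldt d * g d)"
proof -
  have "(\<Sum>d=1..n. mangoldt d * g d) = 
     (\<Sum>d\<in>primes_upto (real n) \<union> {d. d \<in> proper_primepows \<and> d \<le> n}. mangoldt d * g d)"
    by (rule sum.mono_neutral_right)
       (auto simp: primes_upto_def proper_primepows_def mangoldt_def prime_ge_1_nat
          Suc_le_eq primepow_gt_0_nat prime_gt_0_nat)
  also have "\<dots> = (\<Sum>d\<in>primes_upto (real n). mangoldt d * g d)
    + (\<Sum>d | d \<in> proper_primepows \<and> d \<le> n. mangoldt d * g d)"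
    by (rule sum.union_disjoint) (auto simp: primes_upto_def proper_primepows_def)
  also have "(\<Sum>d\<in>primes_upto (real n). mangoldt d * g d)
      = (\<Sum>p\<in>primes_upto (real n). ln (real p) * g p)"
    by (rule sum.cong) (auto simp: primes_upto_def)
  finally show ?thesis .
qed

text \<open>In the formula for ln n! only the primes are kept. Replacing \<open>n div p\<close> by
  n/p costs at most ln p for each prime, which Chebyshev's bound sums to 3n.\<close>

lemma mertens_upper_nat:
  assumes "n \<ge> 1"
  shows "(\<Sum>p\<in>primes_upto (real n). ln (real p) / real p) \<le> ln (real n) + 3"
proof -
  have ln0: "ln (real p) \<ge> 0" if "p \<in> primes_upto (real n)" for p
    using that by (auto simp: primes_upto_def dest: prime_ge_1_nat)
  have "real n * (\<Sum>p\<in>primes_upto (real n). ln (real p) / real p)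
      = (\<Sum>p\<in>primes_upto (real n). ln (real p) * (real n / real p))"
    by (simp add: sum_distrib_left mult_ac)
  also have "\<dots> \<le> (\<Sum>p\<in>primes_upto (real n). ln (real p) * (real (n div p) + 1))"
  proof (intro sum_mono mult_left_mono ln0)
    fix p assume "p \<in> primes_upto (real n)"
    hence p: "p > 0" by (auto simp: primes_upto_def prime_gt_0_nat)
    have "n < p * (n div p + 1)" using p by (simp add: dividend_less_times_div)
    hence "real n \<le> real p * (real (n div p) + 1)"
      by (metis less_imp_le of_nat_1 of_nat_add of_nat_le_iff of_nat_mult)
    thus "real n / real p \<le> real (n div p) + 1" using p by (simp add: field_simps)
  qed
  also have "\<dots> = (\<Sum>p\<in>primes_upto (real n). ln (real p) * real (n div p))
      + (\<Sum>p\<in>primes_upto (real n). ln (real p))"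
    by (simp add: algebra_simps sum.distrib)
  also have "(\<Sum>p\<in>primes_upto (real n). ln (real p) * real (n div p)) \<le> ln (fact n)"
    unfolding ln_fact_mangoldt sum_mangoldt_split
    by (simp add: sum_nonneg mangoldt_nonneg)
  also have "\<dots> \<le> real n * ln (real n)" by (rule ln_fact_le[OF assms])
  also have "(\<Sum>p\<in>primes_upto (real n). ln (real p)) \<le> 3 * real n" by (rule sum_ln_primes_le)
  finally have "real n * (\<Sum>p\<in>primes_upto (real n). ln (real p) / real p) \<le> real n * (ln (real n) + 3)"
    by (simp add: algebra_simps)
  thus ?thesis using assms by (simp add: mult_le_cancel_left)
qed

text \<open>Here \<open>n div d\<close> is rounded up to n/d for all prime powers d. The proper ones
  add only a constant, since mangoldt d / d \<le> 4 d^(-3/4).\<close>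

lemma mertens_lower_nat:
  obtains C :: real where
    "\<And>n. n \<ge> 1 \<Longrightarrow> (\<Sum>p\<in>primes_upto (real n). ln (real p) / real p) \<ge> ln (real n) - C"
proof -
  obtain C0 :: real where C0: "C0 > 0"
    "\<And>N. (\<Sum>d | d \<in> proper_primepows \<and> d \<le> N. real d powr (-3/4)) \<le> C0"
    using sum_proper_primepows_le by blast
  have "(\<Sum>p\<in>primes_upto (real n). ln (real p) / real p) \<ge> ln (real n) - (1 + 4 * C0)"
    if n: "n \<ge> 1" for n
  proof -
    have "real n * ln (real n) - real n \<le> (\<Sum>d=1..n. mangoldt d * real (n div d))"
      using ln_fact_ge[OF n] unfolding ln_fact_mangoldt .
    also have "\<dots> \<le> (\<Sum>d=1..n. mangoldt d * (real n / real d))"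
      by (intro sum_mono mult_left_mono of_nat_div_le_of_nat mangoldt_nonneg)
    also have "\<dots> = real n * (\<Sum>d=1..n. mangoldt d * (1 / real d))"
      by (simp add: sum_distrib_left mult_ac)
    finally have "real n * (ln (real n) - 1) \<le> real n * (\<Sum>d=1..n. mangoldt d * (1 / real d))"
      by (simp add: algebra_simps)
    hence "ln (real n) - 1 \<le> (\<Sum>d=1..n. mangoldt d * (1 / real d))"
      using n by (simp add: mult_le_cancel_left)
    also have "\<dots> = (\<Sum>p\<in>primes_upto (real n). ln (real p) / real p)
       + (\<Sum>d | d \<in> proper_primepows \<and> d \<le> n. mangoldt d * (1 / real d))"
      unfolding sum_mangoldt_split by simp
    also have "(\<Sum>d | d \<in> proper_primepows \<and> d \<le> n. mangoldt d * (1 / real d))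
       \<le> (\<Sum>d | d \<in> proper_primepows \<and> d \<le> n. 4 * real d powr (-3/4))"
    proof (rule sum_mono)
      fix d assume "d \<in> {d. d \<in> proper_primepows \<and> d \<le> n}"
      hence d: "d > 0" by (auto simp: proper_primepows_def primepow_gt_0_nat)
      \<comment> \<open>The inequality ln s \<le> s at s = d^(1/4).\<close>
      have "ln (real d) = 4 * ln (real d powr (1/4))" using d by (simp add: ln_powr)
      also have "\<dots> \<le> 4 * real d powr (1/4)"
        using d ln_bound[of "real d powr (1/4)"] by simp
      finally have "mangoldt d \<le> 4 * real d powr (1/4)" using mangoldt_le[OF d] by linarith
      hence "mangoldt d * (1 / real d) \<le> (4 * real d powr (1/4)) * (1 / real d)"
        by (intro mult_right_mono) auto
      also have "\<dots> = 4 * real d powr (1/4 - 1)" using d by (subst powr_diff) simp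
      finally show "mangoldt d * (1 / real d) \<le> 4 * real d powr (-3/4)" by simp
    qed
    also have "\<dots> \<le> 4 * C0" using C0(2)[of n] by (simp add: sum_distrib_left[symmetric])
    finally show ?thesis by simp
  qed
  thus ?thesis using that by blast
qed

text \<open>Passing to real x costs a constant: the primes up to x are those up to its floor n, and
  x \<le> 2n bounds ln x - ln n by ln 2.\<close>

lemma mertens:
  obtains C :: real where "C > 0" "\<And>x. x \<ge> 1 \<Longrightarrow>
    \<bar>(\<Sum>p\<in>primes_upto x. ln (real p) / real p) - ln x\<bar> \<le> C"
proof -
  obtain C where C: "\<And>n. n \<ge> 1 \<Longrightarrow>
      (\<Sum>p\<in>primes_upto (real n). ln (real p) / real p) \<ge> ln (real n) - C"
    using mertens_lower_nat by blast
  have "\<bar>(\<Sum>p\<in>primes_upto x. ln (real p) / real p) - ln x\<bar> \<le> \<bar>C\<bar> + 4" if x: "x \<ge> 1" for x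
  proof -
    define n where "n = nat \<lfloor>x\<rfloor>"
    have "n \<ge> 1" "real n \<le> x"
      using x unfolding n_def by linarith+
    moreover have "x < real n + 1" using x unfolding n_def by linarith
    ultimately have n: "n \<ge> 1" "real n \<le> x" "x \<le> 2 * real n" by linarith+
    have eq: "primes_upto (real n) = primes_upto x"
      unfolding n_def using x by (intro primes_upto_floor) auto
    have "ln (real n) \<le> ln x" using n x by simp
    moreover have "ln x \<le> ln (2 * real n)" using n x by (subst ln_le_cancel_iff) auto
    moreover have "ln (2 * real n) = ln 2 + ln (real n)" using n by (subst ln_mult) auto
    moreover have "ln 2 \<le> (1 :: real)" using ln2_le_25_over_36 by simp
    ultimately show ?thesis
      using C[OF n(1)] mertens_upper_nat[OF n(1)] unfolding eq by linarith
  qed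
  thus ?thesis using that[of "\<bar>C\<bar> + 4"] by auto
qed

definition primes_between :: "real \<Rightarrow> real \<Rightarrow> nat set" where
  "primes_between y x = {p. prime p \<and> y < real p \<and> real p \<le> x}"

lemma finite_primes_between [simp]: "finite (primes_between y x)"
  by (rule finite_subset[OF _ finite_primes_upto[of x]])
     (auto simp: primes_between_def primes_upto_def)

lemma sum_primes_between_split:
  fixes g :: "nat \<Rightarrow> real"
  assumes "a \<le> b" "b \<le> c"
  shows "sum g (primes_between a c) = sum g (primes_between a b) + sum g (primes_between b c)"
proof -
  have "primes_between a c = primes_between a b \<union> primes_between b c"
    using assms by (auto simp: primes_between_def)
  moreover have "primes_between a b \<inter> primes_between b c = {}"
    by (auto simp: primes_between_def)
  ultimately show ?thesis by (simp add: sum.union_disjoint)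
qed

lemma mertens_between:
  obtains C :: real where "C > 0" "\<And>x y. 1 \<le> y \<Longrightarrow> y \<le> x \<Longrightarrow>
    \<bar>(\<Sum>p\<in>primes_between y x. ln (real p) / real p) - ln (x / y)\<bar> \<le> C"
proof -
  obtain C where C: "C > 0" "\<And>x. x \<ge> 1 \<Longrightarrow>
    \<bar>(\<Sum>p\<in>primes_upto x. ln (real p) / real p) - ln x\<bar> \<le> C"
    using mertens by blast
  have "\<bar>(\<Sum>p\<in>primes_between y x. ln (real p) / real p) - ln (x / y)\<bar> \<le> 2 * C"
    if "1 \<le> y" "y \<le> x" for x y
  proof -
    have "primes_upto x = primes_upto y \<union> primes_between y x"
      using that by (auto simp: primes_upto_def primes_between_def)
    moreover have "primes_upto y \<inter> primes_between y x = {}"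
      by (auto simp: primes_upto_def primes_between_def)
    ultimately have "(\<Sum>p\<in>primes_upto x. ln (real p) / real p)
        = (\<Sum>p\<in>primes_upto y. ln (real p) / real p)
        + (\<Sum>p\<in>primes_between y x. ln (real p) / real p)"
      by (simp add: sum.union_disjoint)
    thus ?thesis using C(2)[of x] C(2)[of y] that by (simp add: ln_div)
  qed
  thus ?thesis using that[of "2 * C"] C(1) by auto
qed

section \<open>Reciprocal sums over primes\<close>

definition sum_inv :: "nat set \<Rightarrow> real" where
  "sum_inv A = (\<Sum>d\<in>A. 1 / real d)"

lemma sum_inv_nonneg: "sum_inv A \<ge> 0"
  unfolding sum_inv_def by (rule sum_nonneg) simp

lemma sum_inv_mono: "A \<subseteq> B \<Longrightarrow> finite B \<Longrightarrow> sum_inv A \<le> sum_inv B"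
  unfolding sum_inv_def by (rule sum_mono2) auto

text \<open>Mertens' theorem gives the block the weight \<epsilon> ln y - C, at least half of
  \<epsilon> ln y once ln y \<ge> 2C/\<epsilon>, which fixes \<open>Y\<close>. As ln p is at most (1
  + \<epsilon>) ln y there, dividing by this bounds the sum of 1/p.\<close>

lemma sum_inv_primes_block:
  assumes eps: "\<epsilon> > 0"
  obtains s Y :: real where "s > 0" "Y > 1"
    "\<And>y. y \<ge> Y \<Longrightarrow> sum_inv (primes_between y (y powr (1 + \<epsilon>))) \<ge> s"
proof -
  obtain C where C: "C > 0" "\<And>x y. 1 \<le> y \<Longrightarrow> y \<le> x \<Longrightarrow>
    \<bar>(\<Sum>p\<in>primes_between y x. ln (real p) / real p) - ln (x / y)\<bar> \<le> C"
    using mertens_between by blast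
  define Y where "Y = exp (2 * C / \<epsilon>)"
  have Y: "Y > 1" using C(1) eps by (simp add: Y_def)
  have "sum_inv (primes_between y (y powr (1 + \<epsilon>))) \<ge> \<epsilon> / (2 * (1 + \<epsilon>))" if y: "y \<ge> Y" for y
  proof -
    define x where "x = y powr (1 + \<epsilon>)"
    have y1: "y > 1" using y Y by simp
    have lny: "ln y \<ge> 2 * C / \<epsilon>" using y y1 unfolding Y_def by (simp add: ln_ge_iff)
    have "y powr 1 \<le> y powr (1 + \<epsilon>)" using y1 eps by (intro powr_mono) auto
    hence yx: "y \<le> x" using y1 by (simp add: x_def)
    have lnx: "ln x = (1 + \<epsilon>) * ln y" using y1 by (simp add: x_def ln_powr)
    have "\<epsilon> / 2 * ln y \<le> \<epsilon> * ln y - C" using lny eps by (simp add: field_simps)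
    also have "\<dots> = ln (x / y) - C" using y1 yx lnx by (simp add: ln_div algebra_simps)
    also have "\<dots> \<le> (\<Sum>p\<in>primes_between y x. ln (real p) / real p)"
      using C(2)[of y x] y1 yx by linarith
    also have "\<dots> \<le> (\<Sum>p\<in>primes_between y x. ln x * (1 / real p))"
    proof (rule sum_mono)
      fix p assume "p \<in> primes_between y x"
      hence p: "real p > 0" "real p \<le> x" using y1 by (auto simp: primes_between_def)
      hence "ln (real p) \<le> ln x" by simp
      thus "ln (real p) / real p \<le> ln x * (1 / real p)" using p by (simp add: divide_right_mono)
    qed
    also have "\<dots> = ln x * sum_inv (primes_between y x)"
      by (simp add: sum_inv_def sum_distrib_left)
    finally have "ln y * (\<epsilon> / 2) \<le> ln y * ((1 + \<epsilon>) * sum_inv (primes_between y x))"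
      by (simp add: lnx mult_ac)
    hence "\<epsilon> / 2 \<le> (1 + \<epsilon>) * sum_inv (primes_between y x)"
      using y1 by (simp add: mult_le_cancel_left)
    thus ?thesis using eps by (simp add: x_def field_simps)
  qed
  thus ?thesis using that[of "\<epsilon> / (2 * (1 + \<epsilon>))" Y] Y eps by simp
qed

text \<open>A lower bound of the order of Mertens' second theorem without partial summation: the
  blocks from y^((1+\<epsilon>)^i) to y^((1+\<epsilon>)^(i+1)) contribute at least s each, and about
  ln(ln x / ln y) / ln(1+\<epsilon>) of them fit below x.\<close>

lemma sum_inv_primes_between_ge:
  assumes eps: "\<epsilon> > 0"
  obtains c Y :: real where "c > 0" "Y > 1"
    "\<And>x y. y \<ge> Y \<Longrightarrow> x \<ge> y powr (1 + \<epsilon>) \<Longrightarrow>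
       sum_inv (primes_between y x) \<ge> c * ln (ln x / ln y)"
proof -
  obtain s Y where sY: "s > 0" "Y > 1"
    "\<And>y. y \<ge> Y \<Longrightarrow> sum_inv (primes_between y (y powr (1 + \<epsilon>))) \<ge> s"
    using sum_inv_primes_block[OF eps] by blast
  have iter: "sum_inv (primes_between y x) \<ge> real k * s"
    if "y \<ge> Y" "x \<ge> y powr ((1 + \<epsilon>) ^ k)" for x y k
    using that
  proof (induction k arbitrary: y)
    case 0
    thus ?case by (simp add: sum_inv_nonneg)
  next
    case (Suc k)
    define z where "z = y powr (1 + \<epsilon>)"
    have y1: "y > 1" using Suc.prems sY by simp
    have "y powr 1 \<le> z" unfolding z_def using y1 eps by (intro powr_mono) auto
    hence yz: "y \<le> z" using y1 by simp
    hence z: "z \<ge> Y" "z > 1" using Suc.prems y1 by auto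
    have zx: "z powr ((1 + \<epsilon>) ^ k) \<le> x"
      using Suc.prems by (simp add: z_def powr_powr)
    have "(1 + \<epsilon>) ^ k \<ge> 1" using eps by simp
    hence "z powr 1 \<le> z powr ((1 + \<epsilon>) ^ k)" using z by (intro powr_mono) auto
    hence "z \<le> x" using zx z by simp
    with yz have "sum_inv (primes_between y x) =
        sum_inv (primes_between y z) + sum_inv (primes_between z x)"
      unfolding sum_inv_def by (rule sum_primes_between_split)
    thus ?case using Suc.IH[OF z(1) zx] sY(3)[OF Suc.prems(1)]
      by (simp add: z_def algebra_simps)
  qed
  have L: "ln (1 + \<epsilon>) > 0" using eps by simp
  have "sum_inv (primes_between y x) \<ge> (s / (2 * ln (1 + \<epsilon>))) * ln (ln x / ln y)"
    if y: "y \<ge> Y" and x: "x \<ge> y powr (1 + \<epsilon>)" for x y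
  proof -
    \<comment> \<open>The real number of blocks that fit. The gap between y and x makes it at least
      1, so its floor is at least R/2 and rounding only halves the constant.\<close>
    define R where "R = ln (ln x / ln y) / ln (1 + \<epsilon>)"
    define k where "k = nat \<lfloor>R\<rfloor>"
    have y1: "y > 1" using y sY by simp
    have xpos: "x > 0" using x y1 powr_gt_zero[of y "1 + \<epsilon>"] by linarith
    have "ln (y powr (1 + \<epsilon>)) \<le> ln x" using x y1 xpos by (subst ln_le_cancel_iff) auto
    hence lnx: "(1 + \<epsilon>) * ln y \<le> ln x" using y1 by (simp add: ln_powr)
    hence q: "1 + \<epsilon> \<le> ln x / ln y" using y1 by (simp add: field_simps)
    hence "ln (1 + \<epsilon>) \<le> ln (ln x / ln y)" using eps by (subst ln_le_cancel_iff) auto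
    hence R1: "R \<ge> 1" using L by (simp add: R_def)
    have kR: "real k = of_int \<lfloor>R\<rfloor>" using R1 by (simp add: k_def)
    have "\<lfloor>R\<rfloor> \<ge> 1" using R1 by simp
    hence "real k \<ge> 1" unfolding kR by simp
    hence k: "real k \<le> R" "real k \<ge> R / 2" unfolding kR by linarith+
    have "(1 + \<epsilon>) ^ k = exp (real k * ln (1 + \<epsilon>))" using eps by (simp add: exp_of_nat_mult)
    also have "\<dots> \<le> exp (R * ln (1 + \<epsilon>))" using k L by simp
    also have "\<dots> = ln x / ln y" using L q eps by (simp add: R_def)
    finally have "(1 + \<epsilon>) ^ k * ln y \<le> ln x" using y1 by (simp add: field_simps)
    hence "exp ((1 + \<epsilon>) ^ k * ln y) \<le> exp (ln x)" by simp
    hence "y powr ((1 + \<epsilon>) ^ k) \<le> x" using y1 xpos by (simp add: powr_def)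
    from iter[OF y this] have "real k * s \<le> sum_inv (primes_between y x)" .
    moreover have "R / 2 * s \<le> real k * s" using k sY by (intro mult_right_mono) auto
    ultimately show ?thesis by (simp add: R_def mult.commute)
  qed
  thus ?thesis using that[of "s / (2 * ln (1 + \<epsilon>))" Y] sY L by simp
qed

lemma sum_inv_primes_sqrt_ge:
  obtains c where "c > 0"
    "eventually (\<lambda>N. sum_inv (primes_upto (sqrt (real N))) \<ge> c * ln (ln (real N))) sequentially"
proof -
  obtain c Y where cY: "c > 0" "Y > 1"
    "\<And>x y. y \<ge> Y \<Longrightarrow> x \<ge> y powr (1 + 1) \<Longrightarrow>
       sum_inv (primes_between y x) \<ge> c * ln (ln x / ln y)"
    using sum_inv_primes_between_ge[of 1] by auto
  have lY: "ln Y > 0" using cY by simp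
  have "eventually (\<lambda>N. sqrt (real N) \<ge> Y powr (1 + 1)) sequentially" by real_asymp
  moreover have "eventually (\<lambda>N. ln (ln (real N) / 2 / ln Y) \<ge> ln (ln (real N)) / 2) sequentially"
    using lY by real_asymp
  moreover have "eventually (\<lambda>N::nat. N > 0) sequentially" by real_asymp
  ultimately have "eventually (\<lambda>N. sum_inv (primes_upto (sqrt (real N)))
      \<ge> (c / 2) * ln (ln (real N))) sequentially"
  proof eventually_elim
    case (elim N)
    have "(c / 2) * ln (ln (real N)) = c * (ln (ln (real N)) / 2)" by simp
    also have "\<dots> \<le> c * ln (ln (real N) / 2 / ln Y)"
      using elim cY by (intro mult_left_mono) auto
    also have "ln (real N) / 2 = ln (sqrt (real N))" using elim by (simp add: ln_sqrt)
    also have "c * ln (ln (sqrt (real N)) / ln Y) \<le> sum_inv (primes_between Y (sqrt (real N)))"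
      using elim by (intro cY) auto
    also have "\<dots> \<le> sum_inv (primes_upto (sqrt (real N)))"
      by (intro sum_inv_mono finite_primes_upto) (auto simp: primes_between_def primes_upto_def)
    finally show ?case .
  qed
  thus ?thesis using that[of "c / 2"] cY by simp
qed

text \<open>Each 1/p is at most ln p / (p ln y). This loses a factor of up to ln x / ln y, so the
  bound is meant for ranges on which that quotient is close to 1.\<close>

lemma sum_inv_primes_between_le:
  obtains C where "C > 0" "\<And>x y. 1 < y \<Longrightarrow> y \<le> x \<Longrightarrow>
    sum_inv (primes_between y x) \<le> (ln (x / y) + C) / ln y"
proof -
  obtain C where C: "C > 0" "\<And>x y. 1 \<le> y \<Longrightarrow> y \<le> x \<Longrightarrow>
    \<bar>(\<Sum>p\<in>primes_between y x. ln (real p) / real p) - ln (x / y)\<bar> \<le> C"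
    using mertens_between by blast
  have "sum_inv (primes_between y x) \<le> (ln (x / y) + C) / ln y" if xy: "1 < y" "y \<le> x" for x y
  proof -
    have "ln y * sum_inv (primes_between y x) = (\<Sum>p\<in>primes_between y x. ln y * (1 / real p))"
      by (simp add: sum_inv_def sum_distrib_left)
    also have "\<dots> \<le> (\<Sum>p\<in>primes_between y x. ln (real p) / real p)"
    proof (rule sum_mono)
      fix p assume "p \<in> primes_between y x"
      hence p: "real p > 0" "y \<le> real p" using xy by (auto simp: primes_between_def)
      hence "ln y \<le> ln (real p)" using xy by simp
      thus "ln y * (1 / real p) \<le> ln (real p) / real p" using p by (simp add: divide_right_mono)
    qed
    also have "\<dots> \<le> ln (x / y) + C" using C(2)[of y x] xy by linarith
    finally show ?thesis using xy by (simp add: field_simps)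
  qed
  thus ?thesis using that C(1) by blast
qed

text \<open>Chebyshev's bound for the prime counting function: primes up to sqrt x are counted
  trivially, and each larger one contributes at least (ln x)/2 to the sum of ln p.\<close>

lemma card_primes_upto_le:
  assumes "x > 1"
  shows "real (card (primes_upto x)) \<le> sqrt x + 6 * x / ln x"
proof -
  define n where "n = nat \<lfloor>x\<rfloor>"
  have n: "real n \<le> x" using assms unfolding n_def by linarith
  have eq: "primes_upto (real n) = primes_upto x"
    unfolding n_def using assms by (intro primes_upto_floor) auto
  have sq: "sqrt x \<ge> 1" "sqrt x \<le> x" "sqrt x > 1" using assms by (auto intro: real_le_lsqrt simp: power2_eq_square)
  have split: "primes_upto x = primes_upto (sqrt x) \<union> primes_between (sqrt x) x"
    using sq by (auto simp: primes_upto_def primes_between_def)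
  have 1: "real (card (primes_upto (sqrt x))) \<le> sqrt x"
  proof -
    have "primes_upto (sqrt x) \<subseteq> {1..nat \<lfloor>sqrt x\<rfloor>}"
      by (auto simp: primes_upto_def le_nat_floor Suc_le_eq prime_gt_0_nat)
    hence "card (primes_upto (sqrt x)) \<le> card {1..nat \<lfloor>sqrt x\<rfloor>}" by (intro card_mono) auto
    hence "card (primes_upto (sqrt x)) \<le> nat \<lfloor>sqrt x\<rfloor>" by simp
    thus ?thesis using sq by linarith
  qed
  have "ln x / 2 * real (card (primes_between (sqrt x) x)) = (\<Sum>p\<in>primes_between (sqrt x) x. ln x / 2)"
    by simp
  also have "\<dots> \<le> (\<Sum>p\<in>primes_between (sqrt x) x. ln (real p))"
  proof (rule sum_mono)
    fix p assume "p \<in> primes_between (sqrt x) x"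
    hence "sqrt x \<le> real p" by (auto simp: primes_between_def)
    hence "ln (sqrt x) \<le> ln (real p)" using sq by (intro ln_mono) linarith+
    thus "ln x / 2 \<le> ln (real p)" using assms by (simp add: ln_sqrt)
  qed
  also have "\<dots> \<le> (\<Sum>p\<in>primes_upto x. ln (real p))"
    by (intro sum_mono2 finite_primes_upto)
       (auto simp: primes_upto_def primes_between_def dest: prime_ge_1_nat)
  also have "\<dots> \<le> 3 * real n" using sum_ln_primes_le[of n] by (simp add: eq)
  also have "\<dots> \<le> 3 * x" using n by simp
  finally have 2: "real (card (primes_between (sqrt x) x)) \<le> 6 * x / ln x"
    using assms by (simp add: field_simps)
  have "card (primes_upto x) \<le> card (primes_upto (sqrt x)) + card (primes_between (sqrt x) x)"
    unfolding split by (rule card_Un_le)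
  thus ?thesis using 1 2 by linarith
qed

text \<open>The constant only has to stay below the main term \<open>98/100\<close> of \<open>sum_divisor_count_twist_ge\<close>. The primes
  above \<open>sqrt N\<close> are split at \<open>N^(3/4)\<close>, which bounds the sum of their reciprocals by about \<open>1/2 + 1/3\<close>.\<close>

lemma sum_min_primes_le:
  "eventually (\<lambda>N. \<forall>p. real p \<le> sqrt (real N) \<and> p > 0 \<longrightarrow>
     (\<Sum>l\<in>primes_upto (real N). min (real p) (real N / real l)) \<le> 17 / 20 * real N) sequentially"
proof -
  obtain C where C: "C > 0" "\<And>x y. 1 < y \<Longrightarrow> y \<le> x \<Longrightarrow>
    sum_inv (primes_between y x) \<le> (ln (x / y) + C) / ln y"
    using sum_inv_primes_between_le by blast
  have "eventually (\<lambda>N. 1 < real N powr (1/2)) sequentially" by real_asymp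
  \<comment> \<open>The main terms tend to (1/4)/(1/2) + (1/4)/(3/4) = 100/120. Together with the
    1/120 granted to the primes below N/p, the bound 101/120 gives 102/120 = 17/20.\<close>
  moreover have "eventually (\<lambda>N. (ln (real N powr (3/4) / real N powr (1/2)) + C) / ln (real N powr (1/2))
     + (ln (real N / real N powr (3/4)) + C) / ln (real N powr (3/4)) \<le> 101 / 120) sequentially"
    by real_asymp
  moreover have "eventually (\<lambda>N. real N powr (1/2) \<le> real N powr (3/4)) sequentially"
    by real_asymp
  moreover have "eventually (\<lambda>N. real N powr (3/4) \<le> real N) sequentially"
    by real_asymp
  moreover have "eventually (\<lambda>N. real N powr (3/4) + 12 * real N / ln (real N) \<le> real N / 120) sequentially"
    by real_asymp
  moreover have "eventually (\<lambda>N::nat. N > 3) sequentially" by real_asymp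
  ultimately show ?thesis
  proof eventually_elim
    case (elim N)
    have N: "real N > 3" using elim by simp
    have sqN: "real N powr (1/2) = sqrt (real N)" by (simp add: powr_half_sqrt)
    have big: "sum_inv (primes_between (sqrt (real N)) (real N)) \<le> 101 / 120"
    proof -
      have "sum_inv (primes_between (sqrt (real N)) (real N)) =
         sum_inv (primes_between (sqrt (real N)) (real N powr (3/4)))
         + sum_inv (primes_between (real N powr (3/4)) (real N))"
        unfolding sum_inv_def using elim sqN by (intro sum_primes_between_split) auto
      moreover have "1 < real N powr (3/4)" using elim by linarith
      ultimately show ?thesis
        using C(2)[of "sqrt (real N)" "real N powr (3/4)"] C(2)[of "real N powr (3/4)" "real N"]
          elim unfolding sqN by linarith
    qed
    show ?case
    proof safe
      fix p :: nat assume p: "real p \<le> sqrt (real N)" "p > 0"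
      \<comment> \<open>At l = N/p the minimum changes from p to N/l. Below it primes are counted;
        above it their reciprocals are summed, and z \<ge> sqrt N places them in the range of
        \<open>big\<close>.\<close>
      define z where "z = real N / real p"
      have "real p * sqrt (real N) \<le> sqrt (real N) * sqrt (real N)"
        using p by (intro mult_right_mono) auto
      hence zs: "z \<ge> sqrt (real N)" using p by (simp add: z_def field_simps)
      have zN: "z \<le> real N" using p by (simp add: z_def divide_le_eq mult_le_cancel_left1)
      have z1: "z > 1" using zs elim sqN by linarith
      have "primes_upto (real N) = primes_upto z \<union> primes_between z (real N)"
        using zN by (auto simp: primes_upto_def primes_between_def)
      moreover have "primes_upto z \<inter> primes_between z (real N) = {}"
        by (auto simp: primes_upto_def primes_between_def)
      ultimately have "(\<Sum>l\<in>primes_upto (real N). min (real p) (real N / real l))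
        = (\<Sum>l\<in>primes_upto z. min (real p) (real N / real l))
        + (\<Sum>l\<in>primes_between z (real N). min (real p) (real N / real l))"
        by (simp add: sum.union_disjoint)
      also have "(\<Sum>l\<in>primes_upto z. min (real p) (real N / real l)) \<le> (\<Sum>l\<in>primes_upto z. real p)"
        by (rule sum_mono) simp
      also have "\<dots> = real p * real (card (primes_upto z))" by simp
      also have "\<dots> \<le> real p * (sqrt z + 6 * z / ln z)"
        by (intro mult_left_mono card_primes_upto_le z1) simp
      also have "\<dots> = real p * sqrt z + 6 * real N / ln z" using p by (simp add: z_def field_simps)
      \<comment> \<open>p sqrt(N/p) = sqrt p sqrt N, and sqrt p \<le> N^(1/4).\<close>
      also have "real p * sqrt z \<le> real N powr (3/4)"
      proof -
        have "real p * sqrt z = sqrt (real p) * (sqrt (real p) * sqrt z)" by simp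
        also have "sqrt (real p) * sqrt z = sqrt (real N)"
          using p by (simp add: z_def flip: real_sqrt_mult)
        also have "sqrt (real p) \<le> sqrt (sqrt (real N))" using p by simp
        also have "sqrt (sqrt (real N)) = real N powr (1/4)"
          by (subst (1 2) powr_half_sqrt[symmetric]) (simp_all add: powr_powr)
        also have "real N powr (1/4) * sqrt (real N) = real N powr (3/4)"
          by (subst powr_half_sqrt[symmetric]) (simp_all flip: powr_add)
        finally show ?thesis by (simp add: mult_right_mono)
      qed
      also have "6 * real N / ln z \<le> 12 * real N / ln (real N)"
      proof -
        have "ln (sqrt (real N)) \<le> ln z" using zs N z1 by (intro ln_mono) auto
        hence "ln (real N) / 2 \<le> ln z" using N by (simp add: ln_sqrt)
        moreover have "ln (real N) > 0" using N by simp
        ultimately have "6 * real N / ln z \<le> 6 * real N / (ln (real N) / 2)"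
          by (intro divide_left_mono) auto
        thus ?thesis by simp
      qed
      also have "(\<Sum>l\<in>primes_between z (real N). min (real p) (real N / real l))
         \<le> (\<Sum>l\<in>primes_between z (real N). real N * (1 / real l))"
        by (rule sum_mono) simp
      also have "\<dots> = real N * sum_inv (primes_between z (real N))"
        by (simp add: sum_inv_def sum_distrib_left)
      also have "real N * sum_inv (primes_between z (real N)) \<le> real N * (101 / 120)"
      proof (rule mult_left_mono)
        have "sum_inv (primes_between z (real N)) \<le> sum_inv (primes_between (sqrt (real N)) (real N))"
          using zs by (intro sum_inv_mono finite_primes_between) (auto simp: primes_between_def)
        thus "sum_inv (primes_between z (real N)) \<le> 101 / 120" using big by linarith
      qed simp
      finally have "(\<Sum>l\<in>primes_upto (real N). min (real p) (real N / real l)) \<le>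
          real N powr (3 / 4) + 12 * real N / ln (real N) + real N * (101 / 120)" by simp
      thus "(\<Sum>l\<in>primes_upto (real N). min (real p) (real N / real l)) \<le> 17 / 20 * real N"
        using elim by linarith
    qed
  qed
qed

text \<open>The minimum is at most p^(1/4) (N/d)^(3/4), by interpolation, and p^(1/4) \<le> N^(1/8).
  The convergent series over d then leaves O(N^(7/8)).\<close>

lemma sum_min_proper_primepows_le:
  "eventually (\<lambda>N. \<forall>p. real p \<le> sqrt (real N) \<and> p > 0 \<longrightarrow>
     (\<Sum>d | d \<in> proper_primepows \<and> d \<le> N. min (real p) (real N / real d)) \<le> real N / 100) sequentially"
proof -
  obtain C :: real where C: "C > 0"
    "\<And>N. (\<Sum>d | d \<in> proper_primepows \<and> d \<le> N. real d powr (-3/4)) \<le> C"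
    using sum_proper_primepows_le by blast
  have "eventually (\<lambda>N. C * real N powr (7/8) \<le> real N / 100) sequentially" by real_asymp
  moreover have "eventually (\<lambda>N::nat. N > 0) sequentially" by real_asymp
  ultimately show ?thesis
  proof eventually_elim
    case (elim N)
    show ?case
    proof safe
      fix p :: nat assume p: "real p \<le> sqrt (real N)" "p > 0"
      have "(\<Sum>d | d \<in> proper_primepows \<and> d \<le> N. min (real p) (real N / real d))
        \<le> (\<Sum>d | d \<in> proper_primepows \<and> d \<le> N. real N powr (7/8) * real d powr (-3/4))"
      proof (rule sum_mono)
        fix d assume "d \<in> {d. d \<in> proper_primepows \<and> d \<le> N}"
        hence d: "real d > 0" by (auto simp: proper_primepows_def primepow_gt_0_nat)
        define m where "m = min (real p) (real N / real d)"
        have m: "m > 0" using p d elim by (simp add: m_def)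
        have "m = m powr (1/4) * m powr (3/4)" using m by (simp flip: powr_add)
        also have "\<dots> \<le> sqrt (real N) powr (1/4) * (real N / real d) powr (3/4)"
          using m p by (intro mult_mono powr_mono2) (auto simp: m_def)
        also have "sqrt (real N) powr (1/4) = real N powr (1/8)"
          by (subst powr_half_sqrt[symmetric]) (simp_all add: powr_powr)
        also have "real N powr (1/8) * (real N / real d) powr (3/4)
            = real N powr (1/8) * real N powr (3/4) / real d powr (3/4)"
          using d by (simp add: powr_divide)
        also have "real N powr (1/8) * real N powr (3/4) = real N powr (7/8)"
          by (subst powr_add[symmetric]) simp
        also have "real N powr (7/8) / real d powr (3/4) = real N powr (7/8) * real d powr (-3/4)"
          by (simp add: powr_minus_divide)
        finally show "min (real p) (real N / real d) \<le> real N powr (7/8) * real d powr (-3/4)"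
          by (simp add: m_def)
      qed
      also have "\<dots> = real N powr (7/8) * (\<Sum>d | d \<in> proper_primepows \<and> d \<le> N. real d powr (-3/4))"
        by (simp add: sum_distrib_left)
      also have "\<dots> \<le> real N powr (7/8) * C" by (intro mult_left_mono C) auto
      also have "\<dots> \<le> real N / 100" using elim by (simp add: mult.commute)
      finally show "(\<Sum>d | d \<in> proper_primepows \<and> d \<le> N. min (real p) (real N / real d)) \<le> real N / 100" .
    qed
  qed
qed

subsection \<open>Correlation with divisibility by a prime\<close>

text \<open>The common form of both functions: \<open>D\<close> is the set of primes for
  \<open>omega\<close> and of all prime powers for \<open>Omega\<close>. The main estimates are
  proved for every \<open>D\<close> between these two sets.\<close>

definition divisor_count :: "nat set \<Rightarrow> nat \<Rightarrow> nat" where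
  "divisor_count D n = card {d \<in> D. d dvd n}"

lemma omega_conv_divisor_count:
  assumes "n \<ge> 1"
  shows "omega n = divisor_count {p. prime p} n"
  unfolding omega_def divisor_count_def using assms by (simp add: prime_factors_dvd)

text \<open>A prime of multiplicity k in n accounts for the k prime powers p, ..., p^k dividing
  n.\<close>

lemma Omega_conv_divisor_count:
  assumes "n \<ge> 1"
  shows "Omega n = divisor_count {d. primepow d} n"
proof -
  have "Omega n = size (image_mset aprimedivisor (mset_set (primepow_factors n)))"
    unfolding Omega_def using assms
    by (subst aprimedivisor_primepow_factors_conv_prime_factorization) auto
  thus ?thesis by (simp add: divisor_count_def primepow_factors_def)
qed

lemma sum_divisor_count:
  fixes g :: "nat \<Rightarrow> real"
  assumes "0 \<notin> D"
  shows "(\<Sum>n=1..N. real (divisor_count D n) * g n)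
    = (\<Sum>d | d \<in> D \<and> d \<le> N. \<Sum>n | n \<in> {1..N} \<and> d dvd n. g n)"
proof -
  have "(\<Sum>n=1..N. real (divisor_count D n) * g n)
     = (\<Sum>n=1..N. \<Sum>d | d \<in> {d. d \<in> D \<and> d \<le> N} \<and> d dvd n. g n)"
  proof (rule sum.cong[OF refl])
    fix n assume n: "n \<in> {1..N}"
    have "{d \<in> D. d dvd n} = {d. d \<in> {d. d \<in> D \<and> d \<le> N} \<and> d dvd n}"
      using n by (auto dest: dvd_imp_le)
    thus "real (divisor_count D n) * g n = (\<Sum>d | d \<in> {d. d \<in> D \<and> d \<le> N} \<and> d dvd n. g n)"
      by (simp add: divisor_count_def)
  qed
  also have "\<dots> = (\<Sum>d | d \<in> D \<and> d \<le> N. \<Sum>n | n \<in> {1..N} \<and> d dvd n. g n)"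
    by (rule sum.swap_restrict) auto
  finally show ?thesis .
qed

text \<open>Summation by parts as an induction. The coefficients up to M sum to -(M mod p); with p -
  1 added at index 0 all partial sums are nonnegative, so a nonincreasing weight leaves at least the
  last partial sum times \<open>v M\<close>.\<close>

lemma sum_antimono_twist_ge:
  fixes v :: "nat \<Rightarrow> real"
  assumes "p \<ge> 1" "v 0 \<le> 1" "\<And>m. m < M \<Longrightarrow> v (Suc m) \<le> v m"
  shows "(\<Sum>m=1..M. ((if p dvd m then real p else 0) - 1) * v m)
     \<ge> - (real p - 1) + (real p - 1 - real (M mod p)) * v M"
  using assms(3)
proof (induction M)
  case 0
  have "(real p - 1) * v 0 \<le> (real p - 1) * 1" using assms by (intro mult_left_mono) auto
  thus ?case by simp
next
  case (Suc M)
  have IH: "(\<Sum>m=1..M. ((if p dvd m then real p else 0) - 1) * v m)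
     \<ge> - (real p - 1) + (real p - 1 - real (M mod p)) * v M"
    using Suc by simp
  have v: "v (Suc M) \<le> v M" using Suc.prems[of M] by simp
  show ?case
  proof (cases "Suc (M mod p) = p")
    case True
    hence "Suc M mod p = 0" by (simp add: mod_Suc)
    moreover from this have "p dvd Suc M" by (simp add: dvd_eq_mod_eq_0)
    moreover have "real (M mod p) = real p - 1" using True by linarith
    ultimately show ?thesis using IH by simp
  next
    case False
    hence m: "Suc M mod p = Suc (M mod p)" by (simp add: mod_Suc)
    hence nd: "\<not> p dvd Suc M" by (simp add: dvd_eq_mod_eq_0)
    have "M mod p < p" using assms(1) by simp
    hence "real p - 1 - real (M mod p) \<ge> 0" by linarith
    hence "(real p - 1 - real (M mod p)) * v (Suc M) \<le> (real p - 1 - real (M mod p)) * v M"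
      using v by (rule mult_left_mono[rotated])
    thus ?thesis using IH m nd by (simp add: algebra_simps)
  qed
qed

text \<open>The bound -p comes from the summation by parts with its nonnegative last term dropped,
  the bound -M from each summand being at least -1.\<close>

lemma sum_antimono_twist_ge_min:
  fixes v :: "nat \<Rightarrow> real"
  assumes "p \<ge> 1" "\<And>m. m \<le> M \<Longrightarrow> 0 \<le> v m \<and> v m \<le> 1" "\<And>m. m < M \<Longrightarrow> v (Suc m) \<le> v m"
  shows "(\<Sum>m=1..M. ((if p dvd m then real p else 0) - 1) * v m) \<ge> - min (real p) (real M)"
proof -
  have "M mod p < p" using assms(1) by simp
  hence "real p - 1 - real (M mod p) \<ge> 0" by linarith
  hence "(real p - 1 - real (M mod p)) * v M \<ge> 0" using assms(2)[of M] by simp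
  moreover have "(\<Sum>m=1..M. ((if p dvd m then real p else 0) - 1) * v m)
     \<ge> - (real p - 1) + (real p - 1 - real (M mod p)) * v M"
    using assms by (intro sum_antimono_twist_ge) auto
  moreover have "(\<Sum>m=1..M. ((if p dvd m then real p else 0) - 1) * v m) \<ge> (\<Sum>m=1..M. - 1)"
  proof (rule sum_mono)
    fix m assume "m \<in> {1..M}"
    hence v: "0 \<le> v m" "v m \<le> 1" using assms(2)[of m] by auto
    have "((if p dvd m then real p else 0) - 1) * v m \<ge> (- 1) * v m"
      using v by (intro mult_right_mono) auto
    thus "- 1 \<le> ((if p dvd m then real p else 0) - 1) * v m" using v by simp
  qed
  ultimately show ?thesis by simp
qed

text \<open>If p divides d, every summand is nonnegative. Otherwise p divides d j exactly when it
  divides j, and the substitution n = d j reduces to all integers up to N/d.\<close>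

lemma sum_twist_multiples_ge:
  fixes w :: "nat \<Rightarrow> real"
  assumes p: "prime p" and d: "d \<ge> 1"
    and w: "\<And>n. n \<le> N \<Longrightarrow> 0 \<le> w n \<and> w n \<le> 1" "\<And>m n. m \<le> n \<Longrightarrow> n \<le> N \<Longrightarrow> w n \<le> w m"
  shows "(\<Sum>n | n \<in> {1..N} \<and> d dvd n. ((if p dvd n then real p else 0) - 1) * w n)
    \<ge> - min (real p) (real N / real d)"
proof (cases "p dvd d")
  case True
  have "(\<Sum>n | n \<in> {1..N} \<and> d dvd n. ((if p dvd n then real p else 0) - 1) * w n) \<ge> 0"
  proof (rule sum_nonneg)
    fix n assume n: "n \<in> {n. n \<in> {1..N} \<and> d dvd n}"
    hence "p dvd n" using True by (auto intro: dvd_trans)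
    thus "0 \<le> ((if p dvd n then real p else 0) - 1) * w n"
      using n w(1)[of n] prime_ge_1_nat[OF p] by simp
  qed
  moreover have "min (real p) (real N / real d) \<ge> 0" by simp
  ultimately show ?thesis by linarith
next
  case False
  have dj: "p dvd d * j \<longleftrightarrow> p dvd j" for j using p False by (simp add: prime_dvd_mult_iff)
  have le: "d * j \<le> N" if "j \<le> N div d" for j
    using that d by (simp add: less_eq_div_iff_mult_less_eq mult.commute)
  have "(\<Sum>n | n \<in> {1..N} \<and> d dvd n. ((if p dvd n then real p else 0) - 1) * w n)
     = (\<Sum>j=1..N div d. ((if p dvd j then real p else 0) - 1) * w (d * j))"
    unfolding sum_multiples[OF d] dj ..
  also have "\<dots> \<ge> - min (real p) (real (N div d))"
  proof (rule sum_antimono_twist_ge_min)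
    fix m assume "m < N div d"
    hence "d * Suc m \<le> N" by (intro le) simp
    thus "w (d * Suc m) \<le> w (d * m)" by (intro w(2)) auto
  qed (use le w(1) p prime_ge_1_nat in auto)
  moreover have "real (N div d) \<le> real N / real d" by (rule of_nat_div_le_of_nat)
  ultimately show ?thesis by linarith
qed

text \<open>With the sum over divisors outermost, d = p gives at least 98/100 N, while the other
  divisors lose at most 17/20 N on primes and 1/100 N on proper prime powers. The weight
  \<open>w\<close> will be a cosine close to 1 that decreases in n.\<close>

lemma sum_divisor_count_twist_ge:
  "eventually (\<lambda>N. \<forall>D p w. {q. prime q} \<subseteq> D \<longrightarrow> D \<subseteq> {d. primepow d} \<longrightarrow> prime p \<longrightarrow>
     1000 \<le> p \<longrightarrow> real p \<le> sqrt (real N) \<longrightarrow>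
     (\<forall>n\<le>N. 99/100 \<le> w n \<and> w n \<le> 1) \<longrightarrow> (\<forall>m n. m \<le> n \<longrightarrow> n \<le> N \<longrightarrow> w n \<le> w m) \<longrightarrow>
     (\<Sum>n=1..N. real (divisor_count D n) * (((if p dvd n then real p else 0) - 1) * w n))
       \<ge> real N / 10) sequentially"
  using sum_min_primes_le sum_min_proper_primepows_le
proof eventually_elim
  case (elim N)
  show ?case
  proof (intro allI impI)
    fix D :: "nat set" and p :: nat and w :: "nat \<Rightarrow> real"
    assume D: "{q. prime q} \<subseteq> D" "D \<subseteq> {d. primepow d}" and p: "prime p" "1000 \<le> p" "real p \<le> sqrt (real N)"
      and w: "\<forall>n\<le>N. 99/100 \<le> w n \<and> w n \<le> 1" "\<forall>m n. m \<le> n \<longrightarrow> n \<le> N \<longrightarrow> w n \<le> w m"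
    have w': "0 \<le> w n \<and> w n \<le> 1" if "n \<le> N" for n using w(1) that by fastforce
    define T where "T d = (\<Sum>n | n \<in> {1..N} \<and> d dvd n. ((if p dvd n then real p else 0) - 1) * w n)" for d
    define A where "A = {d. d \<in> D \<and> d \<le> N}"
    have finA: "finite A" unfolding A_def by simp
    have D0: "0 \<notin> D" using D(2) by auto
    have "real p * real p \<le> sqrt (real N) * sqrt (real N)" using p by (intro mult_mono) auto
    hence pp: "real p * real p \<le> real N" by simp
    have "real p * 1000 \<le> real p * real p" using p by (intro mult_left_mono) auto
    hence pN: "1000 * real p \<le> real N" using pp by simp
    hence pA: "p \<in> A" using p D by (auto simp: A_def)
    \<comment> \<open>There are more than N/p - 1 multiples of p, each contributing at least (p - 1)
      99/100. Since p \<ge> 1000 and p^2 \<le> N, both p and N/p are at most N/1000, so little is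
      lost.\<close>
    have Tp: "T p \<ge> 98 / 100 * real N"
    proof -
      have "T p = (\<Sum>n | n \<in> {1..N} \<and> p dvd n. (real p - 1) * w n)"
        unfolding T_def by (rule sum.cong) auto
      also have "\<dots> \<ge> (\<Sum>n | n \<in> {1..N} \<and> p dvd n. (real p - 1) * (99 / 100))"
        using p w(1) by (intro sum_mono mult_left_mono) auto
      also have "(\<Sum>n | n \<in> {1..N} \<and> p dvd n. (real p - 1) * (99 / 100 :: real))
          = real (N div p) * ((real p - 1) * (99 / 100))"
        using p by (subst sum_multiples) auto
      finally have 1: "T p \<ge> real (N div p) * ((real p - 1) * (99 / 100))" .
      have "N < p * (N div p + 1)" using p by (simp add: dividend_less_times_div)
      hence "real N \<le> real p * (real (N div p) + 1)"
        by (metis less_imp_le of_nat_1 of_nat_add of_nat_le_iff of_nat_mult)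
      hence "(real N - real p) / real p \<le> real (N div p)" using p by (simp add: field_simps)
      hence "(real N - real p) / real p * ((real p - 1) * (99 / 100))
          \<le> real (N div p) * ((real p - 1) * (99 / 100))"
        using p by (intro mult_right_mono) auto
      also have "(real N - real p) / real p * ((real p - 1) * (99 / 100))
          = 99 / 100 * (real N - real N / real p - real p + 1)"
        using p by (simp add: field_simps)
      finally have 2: "99 / 100 * (real N - real N / real p - real p + 1)
          \<le> real (N div p) * ((real p - 1) * (99 / 100))" .
      have "real N / real p \<le> real N / 1000" using p by (intro divide_left_mono) auto
      moreover have "98 / 100 * x \<le> b" if "u \<le> x / 1000" "99 / 100 * (x - u - y + 1) \<le> b"
          "1000 * y \<le> x" "0 \<le> x" for u x y b :: real
        using that by (simp add: field_simps)
      ultimately show ?thesis using order.trans[OF 2 1] pN by (metis of_nat_0_le_iff)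
    qed
    have other: "T d \<ge> - min (real p) (real N / real d)" if "d \<in> A" for d
    proof -
      have "d \<ge> 1" using that D(2) by (auto simp: A_def Suc_le_eq primepow_gt_0_nat)
      thus ?thesis unfolding T_def
        by (rule sum_twist_multiples_ge[OF p(1)]) (use w w' in auto)
    qed
    have "(\<Sum>d\<in>A - {p}. min (real p) (real N / real d)) \<le>
        (\<Sum>d\<in>primes_upto (real N) \<union> {d. d \<in> proper_primepows \<and> d \<le> N}. min (real p) (real N / real d))"
    proof (rule sum_mono2)
      show "A - {p} \<subseteq> primes_upto (real N) \<union> {d. d \<in> proper_primepows \<and> d \<le> N}"
        using D by (auto simp: A_def primes_upto_def proper_primepows_def)
    qed auto
    also have "\<dots> = (\<Sum>d\<in>primes_upto (real N). min (real p) (real N / real d))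
        + (\<Sum>d | d \<in> proper_primepows \<and> d \<le> N. min (real p) (real N / real d))"
      by (rule sum.union_disjoint) (auto simp: primes_upto_def proper_primepows_def)
    also have "\<dots> \<le> 17 / 20 * real N + real N / 100"
      using elim p by (intro add_mono) auto
    finally have "(\<Sum>d\<in>A - {p}. - min (real p) (real N / real d)) \<ge> - (86 / 100 * real N)"
      by (simp add: sum_negf)
    moreover have "(\<Sum>d\<in>A - {p}. T d) \<ge> (\<Sum>d\<in>A - {p}. - min (real p) (real N / real d))"
      by (intro sum_mono other) auto
    moreover have "(\<Sum>d\<in>A. T d) = T p + (\<Sum>d\<in>A - {p}. T d)"
      by (rule sum.remove[OF finA pA])
    moreover have "(\<Sum>n=1..N. real (divisor_count D n) * (((if p dvd n then real p else 0) - 1) * w n)) = (\<Sum>d\<in>A. T d)"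
      unfolding A_def T_def by (rule sum_divisor_count[OF D0])
    ultimately show "(\<Sum>n=1..N. real (divisor_count D n) * (((if p dvd n then real p else 0) - 1) * w n))
       \<ge> real N / 10" using Tp by linarith
  qed
qed

section \<open>Exponential sums near the fractions a/p\<close>

text \<open>For prime p this is the Ramanujan sum: the geometric sum over all p-th roots of unity
  less its term a = 0. It turns shifts by a/p into a test for divisibility by p.\<close>

lemma sum_nontrivial_roots_of_unity:
  assumes "p \<ge> 1"
  shows "(\<Sum>a=1..<p. exp (2 * of_real pi * \<i> * of_nat n * of_real (real a / real p)))
     = (if p dvd n then of_nat p else 0) - (1 :: complex)"
proof -
  define z where "z = exp (2 * of_real pi * \<i> * of_nat n / of_nat p :: complex)"
  have zp: "z ^ p = 1"
  proof -
    have "z ^ p = exp (of_nat p * (2 * of_real pi * \<i> * of_nat n / of_nat p))"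
      unfolding z_def by (simp only: exp_of_nat_mult)
    also have "\<dots> = exp (of_nat n * (2 * of_real pi * \<i>))" using assms by (simp add: mult_ac)
    also have "\<dots> = 1" by (simp only: exp_of_nat_mult exp_two_pi_i power_one)
    finally show ?thesis .
  qed
  have z1: "z = 1 \<longleftrightarrow> p dvd n"
  proof
    assume "z = 1"
    then obtain k :: int where "2 * pi * real n / real p = of_int (2 * k) * pi"
      unfolding z_def by (auto simp: exp_eq_1)
    hence "real n = of_int k * real p" using assms by (simp add: field_simps)
    hence "int n = k * int p" by (metis of_int_eq_iff of_int_mult of_int_of_nat_eq)
    thus "p dvd n" by (metis dvd_triv_right int_dvd_int_iff)
  next
    assume "p dvd n"
    then obtain k where "n = p * k" by blast
    hence "z = exp (of_nat k * (2 * of_real pi * \<i>))" using assms by (simp add: z_def mult_ac)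
    also have "\<dots> = 1" by (simp only: exp_of_nat_mult exp_two_pi_i power_one)
    finally show "z = 1" .
  qed
  have "(\<Sum>a=1..<p. exp (2 * of_real pi * \<i> * of_nat n * of_real (real a / real p)))
      = (\<Sum>a=1..<p. z ^ a)"
    unfolding z_def by (intro sum.cong refl) (simp add: mult_ac flip: exp_of_nat_mult)
  also have "\<dots> = (\<Sum>a<p. z ^ a) - 1"
  proof -
    have "{..<p} = insert 0 {1..<p}" using assms by auto
    thus ?thesis by simp
  qed
  also have "(\<Sum>a<p. z ^ a) = (if p dvd n then of_nat p else 0)"
    using geometric_sum[of z p] zp z1 by auto
  finally show ?thesis .
qed

lemma Re_sum_exp_sum_shifts:
  fixes f :: "nat \<Rightarrow> nat"
  assumes "p \<ge> 1"
  shows "Re (\<Sum>a=1..<p. exp_sum (\<lambda>n. of_nat (f n)) N (real a / real p + t))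
    = (\<Sum>n=1..N. real (f n) * (((if p dvd n then real p else 0) - 1) * cos (2 * pi * real n * t)))"
proof -
  have "(\<Sum>a=1..<p. exp_sum (\<lambda>n. of_nat (f n)) N (real a / real p + t)) =
     (\<Sum>n=1..N. \<Sum>a=1..<p. of_nat (f n) * exp (2 * of_real pi * \<i> * of_nat n * of_real (real a / real p + t)))"
    unfolding exp_sum_def by (rule sum.swap)
  also have "\<dots> = (\<Sum>n=1..N. of_nat (f n) * exp (2 * of_real pi * \<i> * of_nat n * of_real t) *
      (\<Sum>a=1..<p. exp (2 * of_real pi * \<i> * of_nat n * of_real (real a / real p))))"
    by (simp add: sum_distrib_left exp_add ring_distribs mult_ac)
  also have "\<dots> = (\<Sum>n=1..N. of_nat (f n) * exp (2 * of_real pi * \<i> * of_nat n * of_real t) *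
      of_real ((if p dvd n then real p else 0) - 1))"
    by (intro sum.cong refl, subst sum_nontrivial_roots_of_unity[OF assms]) auto
  also have "Re \<dots> = (\<Sum>n=1..N. Re (of_nat (f n) * exp (2 * of_real pi * \<i> * of_nat n * of_real t) *
      of_real ((if p dvd n then real p else 0) - 1)))"
    by simp
  also have "\<dots> = (\<Sum>n=1..N. real (f n) * (((if p dvd n then real p else 0) - 1) * cos (2 * pi * real n * t)))"
    by (intro sum.cong refl) (simp add: Re_exp)
  finally show ?thesis .
qed

lemma cos_ge_one_minus_half_square: "cos x \<ge> 1 - x\<^sup>2 / (2::real)"
proof -
  have "\<bar>sin (x/2)\<bar> \<le> \<bar>x/2\<bar>" by (rule abs_sin_x_le_abs_x)
  hence "(sin (x/2))\<^sup>2 \<le> (x/2)\<^sup>2" by (simp only: abs_le_square_iff)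
  moreover have "cos x = 1 - 2 * (sin (x/2))\<^sup>2" using cos_double_sin[of "x/2"] by simp
  ultimately show ?thesis by (simp add: power_divide)
qed

text \<open>On this range of t the cosines are an admissible weight in
  \<open>sum_divisor_count_twist_ge\<close>, so the sum of the p - 1 values is at least N/10 in
  modulus. Cauchy-Schwarz passes to squares.\<close>

lemma sum_norm_exp_sum_shifts_ge:
  "eventually (\<lambda>N. \<forall>D p t. {q. prime q} \<subseteq> D \<longrightarrow> D \<subseteq> {d. primepow d} \<longrightarrow> prime p \<longrightarrow>
     1000 \<le> p \<longrightarrow> real p \<le> sqrt (real N) \<longrightarrow> 0 \<le> t \<longrightarrow> t \<le> 1 / (50 * real N) \<longrightarrow>
     (\<Sum>a=1..<p. (cmod (exp_sum (\<lambda>n. of_nat (divisor_count D n)) N (real a / real p + t)))\<^sup>2)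
       \<ge> (real N)\<^sup>2 / (100 * real p)) sequentially"
  using sum_divisor_count_twist_ge eventually_gt_at_top[of 0]
proof eventually_elim
  case (elim N)
  show ?case
  proof (intro allI impI)
    fix D :: "nat set" and p :: nat and t :: real
    assume D: "{q. prime q} \<subseteq> D" "D \<subseteq> {d. primepow d}" and p: "prime p" "1000 \<le> p" "real p \<le> sqrt (real N)"
      and t: "0 \<le> t" "t \<le> 1 / (50 * real N)"
    define S where "S a = exp_sum (\<lambda>n. of_nat (divisor_count D n)) N (real a / real p + t)" for a
    \<comment> \<open>2 pi < 7 gives phases of at most 7/50, so the cosine is at least 1 -
      (7/50)^2/2 > 99/100, and it decreases with n because the phases stay in [0, pi].\<close>
    have bd: "0 \<le> 2 * pi * real n * t \<and> 2 * pi * real n * t \<le> 7 / 50" if "n \<le> N" for n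
    proof -
      have "real n * t \<le> real N * (1 / (50 * real N))" using that t by (intro mult_mono) auto
      hence "real n * t \<le> 1 / 50" using elim by simp
      hence "(2 * pi) * (real n * t) \<le> 7 * (1 / 50)"
        using pi_less_4 pi_approx t by (intro mult_mono) auto
      thus ?thesis using t by (simp add: mult_ac)
    qed
    have "real N / 10 \<le> (\<Sum>n=1..N. real (divisor_count D n) *
        (((if p dvd n then real p else 0) - 1) * cos (2 * pi * real n * t)))"
    proof -
      have "99/100 \<le> cos (2 * pi * real n * t) \<and> cos (2 * pi * real n * t) \<le> 1" if "n \<le> N" for n
      proof -
        have "(2 * pi * real n * t)\<^sup>2 \<le> (7 / 50)\<^sup>2" using bd[OF that] by (intro power_mono) auto
        hence "(2 * pi * real n * t)\<^sup>2 / 2 \<le> 1 / 100" by (simp only: power2_eq_square)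
        thus ?thesis using cos_ge_one_minus_half_square[of "2 * pi * real n * t"] by simp
      qed
      moreover have "cos (2 * pi * real n * t) \<le> cos (2 * pi * real m * t)" if "m \<le> n" "n \<le> N" for m n
      proof (rule cos_monotone_0_pi_le)
        show "0 \<le> 2 * pi * real m * t" using t by simp
        show "2 * pi * real m * t \<le> 2 * pi * real n * t"
          using that t by (intro mult_right_mono mult_left_mono) auto
        show "2 * pi * real n * t \<le> pi" using bd[OF that(2)] pi_ge_two by linarith
      qed
      ultimately show ?thesis
        by (intro elim(1)[rule_format, of D p "\<lambda>n. cos (2 * pi * real n * t)"]) (use D p in auto)
    qed
    also have "\<dots> = Re (\<Sum>a=1..<p. S a)"
      unfolding S_def using p prime_ge_1_nat by (subst Re_sum_exp_sum_shifts) auto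
    also have "\<dots> \<le> cmod (\<Sum>a=1..<p. S a)" by (rule complex_Re_le_cmod)
    also have "\<dots> \<le> (\<Sum>a=1..<p. cmod (S a))" by (rule norm_sum)
    finally have "(real N / 10)\<^sup>2 \<le> (\<Sum>a=1..<p. cmod (S a))\<^sup>2" by (intro power_mono) auto
    also have "\<dots> \<le> (\<Sum>a=1..<p. (cmod (S a))\<^sup>2) * real (card {1..<p})"
      by (rule sum_squared_le_sum_of_squares)
    also have "\<dots> \<le> (\<Sum>a=1..<p. (cmod (S a))\<^sup>2) * real p"
      by (intro mult_left_mono sum_nonneg) auto
    finally show "(\<Sum>a=1..<p. (cmod (S a))\<^sup>2) \<ge> (real N)\<^sup>2 / (100 * real p)"
      using p by (simp add: field_simps power2_eq_square)
  qed
qed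

subsection \<open>The neighbourhood of zero\<close>

lemma abs_cos_diff_le: "\<bar>cos x - cos y\<bar> \<le> \<bar>x - y\<bar>" for x y :: real
proof -
  have "\<bar>cos x - cos y\<bar> = 2 * (\<bar>sin ((x + y) / 2)\<bar> * \<bar>sin ((y - x) / 2)\<bar>)"
    by (simp add: cos_diff_cos abs_mult)
  also have "\<dots> \<le> 2 * (1 * \<bar>(y - x) / 2\<bar>)"
    by (intro mult_left_mono mult_mono abs_sin_x_le_abs_x) auto
  finally show ?thesis by simp
qed

lemma half_le_sin: "x / 2 \<le> sin x" if "0 \<le> x" "x \<le> 1" for x :: real
proof (cases "x = 0")
  case False
  with that have x: "0 < x" by simp
  obtain z where z: "0 < z" "z < x" "sin x - sin 0 = (x - 0) * cos z"
    using MVT2[OF x, of sin cos] by (auto intro: derivative_eq_intros)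
  have "z\<^sup>2 \<le> 1\<^sup>2" using z that by (intro power_mono) auto
  hence "cos z \<ge> 1 / 2" using cos_ge_one_minus_half_square[of z] by simp
  hence "x * (1 / 2) \<le> x * cos z" using x by (intro mult_left_mono) auto
  thus ?thesis using z by simp
qed auto

text \<open>The product formula turns each summand into a difference of cosines half a step to
  either side.\<close>

lemma sin_progression_telescope:
  fixes a d x :: real
  shows "2 * sin (d * x / 2) * (\<Sum>j=1..M. sin ((a - d * real j) * x))
    = cos ((a - d * real M - d / 2) * x) - cos ((a - d / 2) * x)"
proof (induction M)
  case (Suc M)
  have "2 * sin (d * x / 2) * sin ((a - d * real (Suc M)) * x)
     = cos (d * x / 2 - (a - d * real (Suc M)) * x) - cos (d * x / 2 + (a - d * real (Suc M)) * x)"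
    by (simp add: cos_diff cos_add)
  also have "cos (d * x / 2 - (a - d * real (Suc M)) * x) = cos (- (d * x / 2 - (a - d * real (Suc M)) * x))"
    by (simp only: cos_minus)
  also have "- (d * x / 2 - (a - d * real (Suc M)) * x) = (a - d * real (Suc M) - d / 2) * x"
    by (simp add: algebra_simps)
  also have "d * x / 2 + (a - d * real (Suc M)) * x = (a - d * real M - d / 2) * x"
    by (simp add: algebra_simps)
  finally show ?case using Suc by (simp add: distrib_left)
qed simp

text \<open>By telescoping, the sum is a difference of two cosines over 2 sin(dx/2). The first
  argument is at most dx/2 in size, as N - d (N div d) < d, so that cosine is nearly 1; the second
  is within dx/2 of cos(Nx). Sines are chosen because the resulting main term is nonnegative for
  every x.\<close>

lemma sum_sin_multiples_ge:
  assumes d: "d \<ge> 1" and x: "0 < x" "real d * x \<le> 1"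
  shows "(\<Sum>n | n \<in> {1..N} \<and> d dvd n. sin (real (N - n) * x))
    \<ge> (1 - cos (real N * x)) / (real d * x) - 2"
proof -
  define M where "M = N div d"
  define \<Sigma> where "\<Sigma> = (\<Sum>j=1..M. sin ((real N - real d * real j) * x))"
  have le: "d * j \<le> N" if "j \<le> M" for j
    using that d unfolding M_def by (simp add: less_eq_div_iff_mult_less_eq mult.commute)
  have eq: "(\<Sum>n | n \<in> {1..N} \<and> d dvd n. sin (real (N - n) * x)) = \<Sigma>"
    unfolding \<Sigma>_def sum_multiples[OF d] M_def[symmetric]
    using le by (intro sum.cong) (auto simp: of_nat_diff)
  define s where "s = 2 * sin (real d * x / 2)"
  have dx: "real d * x > 0" using d x by simp
  have s: "s \<le> real d * x" "s \<ge> real d * x / 2" "s > 0"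
    using sin_x_le_x[of "real d * x / 2"] half_le_sin[of "real d * x / 2"] dx x by (auto simp: s_def)
  have tel: "s * \<Sigma> = cos ((real N - real d * real M - real d / 2) * x) - cos ((real N - real d / 2) * x)"
    unfolding s_def \<Sigma>_def by (rule sin_progression_telescope)
  have "real d * real M + real (N mod d) = real N"
    unfolding M_def by (metis mult_div_mod_eq of_nat_add of_nat_mult)
  moreover have "N mod d < d" using d by simp
  ultimately have "\<bar>real N - real d * real M - real d / 2\<bar> \<le> real d / 2"
    unfolding abs_le_iff by linarith
  hence "\<bar>(real N - real d * real M - real d / 2) * x\<bar> \<le> real d / 2 * x"
    using x by (simp add: abs_mult mult_right_mono)
  hence "((real N - real d * real M - real d / 2) * x)\<^sup>2 \<le> (real d * x / 2)\<^sup>2"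
    using dx by (subst abs_le_square_iff[symmetric]) simp
  also have "(real d * x / 2)\<^sup>2 = real d * x * (real d * x) / 4" by (simp add: power2_eq_square)
  also have "\<dots> \<le> real d * x * 1 / 4" using x dx by (intro divide_right_mono mult_left_mono) auto
  finally have c1: "cos ((real N - real d * real M - real d / 2) * x) \<ge> 1 - real d * x / 8"
    using cos_ge_one_minus_half_square[of "(real N - real d * real M - real d / 2) * x"] by simp
  have "\<bar>cos ((real N - real d / 2) * x) - cos (real N * x)\<bar> \<le> \<bar>(real N - real d / 2) * x - real N * x\<bar>"
    by (rule abs_cos_diff_le)
  also have "\<dots> = real d * x / 2" using dx x by (simp add: algebra_simps abs_mult)
  finally have "s * \<Sigma> \<ge> 1 - cos (real N * x) - real d * x" using c1 tel dx by linarith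
  hence "\<Sigma> \<ge> (1 - cos (real N * x) - real d * x) / s" using s by (simp add: field_simps)
  also have "(1 - cos (real N * x) - real d * x) / s = (1 - cos (real N * x)) / s - real d * x / s"
    by (simp add: diff_divide_distrib)
  finally have "\<Sigma> \<ge> (1 - cos (real N * x)) / s - real d * x / s" .
  moreover have "(1 - cos (real N * x)) / s \<ge> (1 - cos (real N * x)) / (real d * x)"
    using s dx by (intro divide_left_mono) auto
  moreover have "real d * x / s \<le> 2" using s by (simp add: field_simps)
  ultimately show ?thesis unfolding eq by linarith
qed

section \<open>A bump function and its sine integrals\<close>

text \<open>A parabola with maximum \<eta>^2 at 2\<eta>. Being quadratic it has explicit
  antiderivatives against sines, and vanishing at \<eta> and 3\<eta> gives decay fast enough for
  absolute summability.\<close>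

definition bump :: "real \<Rightarrow> real \<Rightarrow> real" where
  "bump \<eta> x = (x - \<eta>) * (3 * \<eta> - x)"

lemma bump_nonneg: "x \<in> {\<eta>..3*\<eta>} \<Longrightarrow> 0 \<le> bump \<eta> x"
  by (auto simp: bump_def)

lemma bump_le: "bump \<eta> x \<le> \<eta>\<^sup>2"
proof -
  have "\<eta>\<^sup>2 - bump \<eta> x = (x - 2 * \<eta>)\<^sup>2" by (simp add: bump_def power2_eq_square algebra_simps)
  thus ?thesis using zero_le_power2[of "x - 2 * \<eta>"] by linarith
qed

lemma continuous_on_bump [continuous_intros]: "continuous_on A (bump \<eta>)"
  unfolding bump_def by (intro continuous_intros)

lemma integral_bump:
  assumes "\<eta> > 0"
  shows "(bump \<eta> has_integral 4 / 3 * \<eta> ^ 3) {\<eta>..3*\<eta>}"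
proof -
  define H where "H x = - (x ^ 3) / 3 + 2 * \<eta> * x\<^sup>2 - 3 * \<eta>\<^sup>2 * x" for x
  have "(bump \<eta> has_integral (H (3*\<eta>) - H \<eta>)) {\<eta>..3*\<eta>}"
  proof (rule fundamental_theorem_of_calculus)
    fix x assume "x \<in> {\<eta>..3*\<eta>}"
    have "(H has_real_derivative bump \<eta> x) (at x within {\<eta>..3*\<eta>})"
      unfolding H_def bump_def
      by (auto intro!: derivative_eq_intros simp: power2_eq_square algebra_simps)
    thus "(H has_vector_derivative bump \<eta> x) (at x within {\<eta>..3*\<eta>})"
      by (simp add: has_real_derivative_iff_has_vector_derivative)
  qed (use assms in simp)
  moreover have "H (3*\<eta>) - H \<eta> = 4 / 3 * \<eta> ^ 3"
    by (simp add: H_def power2_eq_square power3_eq_cube field_simps)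
  ultimately show ?thesis by simp
qed

text \<open>The phase \<open>\<phi>\<close> lets one bound cover sines (\<phi> = 0) and cosines
  (\<phi> = pi/2).\<close>

definition bump_sin :: "real \<Rightarrow> real \<Rightarrow> real \<Rightarrow> real" where
  "bump_sin \<eta> u \<phi> = integral {\<eta>..3*\<eta>} (\<lambda>x. bump \<eta> x * sin (u * x + \<phi>))"

lemma bump_sin_integrable: "(\<lambda>x. bump \<eta> x * sin (u * x + \<phi>)) integrable_on {\<eta>..3*\<eta>}"
  by (intro integrable_continuous_real continuous_intros)

lemma bump_sin_trivial_bound:
  assumes "\<eta> > 0"
  shows "\<bar>bump_sin \<eta> u \<phi>\<bar> \<le> 4 / 3 * \<eta> ^ 3"
proof -
  have "\<bar>bump_sin \<eta> u \<phi>\<bar> \<le> integral {\<eta>..3*\<eta>} (bump \<eta>)"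
    unfolding bump_sin_def real_norm_def[symmetric]
  proof (rule integral_norm_bound_integral)
    fix x assume x: "x \<in> {\<eta>..3*\<eta>}"
    have "\<bar>bump \<eta> x\<bar> * \<bar>sin (u * x + \<phi>)\<bar> \<le> \<bar>bump \<eta> x\<bar> * 1"
      by (intro mult_left_mono) auto
    thus "norm (bump \<eta> x * sin (u * x + \<phi>)) \<le> bump \<eta> x"
      using bump_nonneg[OF x] by (simp add: abs_mult)
  qed (use integral_bump[OF assms] bump_sin_integrable in auto)
  thus ?thesis using integral_unique[OF integral_bump[OF assms]] by simp
qed

text \<open>Integrating by parts twice: the bump vanishes at the endpoints, so two powers of \<open>u\<close> are gained.\<close>

lemma bump_sin_decay_bound:
  assumes "\<eta> > 0" "u \<noteq> 0"
  shows "\<bar>bump_sin \<eta> u \<phi>\<bar> \<le> 8 * \<eta> / u\<^sup>2"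
proof -
  \<comment> \<open>The antiderivative from repeated integration by parts: its coefficients are the
    bump and its derivatives 4\<eta> - 2x and -2.\<close>
  define H where "H x = - bump \<eta> x * cos (u * x + \<phi>) / u + (4 * \<eta> - 2 * x) * sin (u * x + \<phi>) / u\<^sup>2
    - 2 * cos (u * x + \<phi>) / u ^ 3" for x
  have "((\<lambda>x. bump \<eta> x * sin (u * x + \<phi>)) has_integral (H (3*\<eta>) - H \<eta>)) {\<eta>..3*\<eta>}"
  proof (rule fundamental_theorem_of_calculus)
    fix x assume "x \<in> {\<eta>..3*\<eta>}"
    have "(H has_real_derivative bump \<eta> x * sin (u * x + \<phi>)) (at x within {\<eta>..3*\<eta>})"
      unfolding H_def bump_def using assms
      by (auto intro!: derivative_eq_intros simp: power2_eq_square power3_eq_cube field_simps)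
    thus "(H has_vector_derivative bump \<eta> x * sin (u * x + \<phi>)) (at x within {\<eta>..3*\<eta>})"
      by (simp add: has_real_derivative_iff_has_vector_derivative)
  qed (use assms in simp)
  hence "bump_sin \<eta> u \<phi> = H (3*\<eta>) - H \<eta>" unfolding bump_sin_def by (rule integral_unique)
  also have "\<dots> = - (2 * \<eta> * (sin (u * (3*\<eta>) + \<phi>) + sin (u * \<eta> + \<phi>))) / u\<^sup>2
     - 2 * (cos (u * (3*\<eta>) + \<phi>) - cos (u * \<eta> + \<phi>)) / u ^ 3"
    by (simp add: H_def bump_def diff_divide_distrib add_divide_distrib ring_distribs)
  \<comment> \<open>The two cosines have arguments 2\<eta>|u| apart, which trades one power of u for
    \<eta>, so the last term is also of order \<eta>/u^2.\<close>
  also have "\<bar>\<dots>\<bar> \<le> 2 * \<eta> * 2 / u\<^sup>2 + 2 * (\<bar>u\<bar> * (2 * \<eta>)) / \<bar>u\<bar> ^ 3"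
  proof -
    have "\<bar>sin (u * (3*\<eta>) + \<phi>) + sin (u * \<eta> + \<phi>)\<bar> \<le> 1 + 1"
      by (intro order.trans[OF abs_triangle_ineq] add_mono) auto
    hence "2 * \<eta> * \<bar>sin (u * (3*\<eta>) + \<phi>) + sin (u * \<eta> + \<phi>)\<bar> / u\<^sup>2 \<le> 2 * \<eta> * 2 / u\<^sup>2"
      using assms by (intro divide_right_mono mult_left_mono) auto
    moreover have "\<bar>cos (u * (3*\<eta>) + \<phi>) - cos (u * \<eta> + \<phi>)\<bar> \<le> \<bar>(u * (3*\<eta>) + \<phi>) - (u * \<eta> + \<phi>)\<bar>"
      by (rule abs_cos_diff_le)
    hence "\<bar>cos (u * (3*\<eta>) + \<phi>) - cos (u * \<eta> + \<phi>)\<bar> \<le> \<bar>u\<bar> * (2 * \<eta>)"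
      using assms by (simp add: algebra_simps abs_mult)
    hence "2 * \<bar>cos (u * (3*\<eta>) + \<phi>) - cos (u * \<eta> + \<phi>)\<bar> / \<bar>u\<bar> ^ 3 \<le> 2 * (\<bar>u\<bar> * (2 * \<eta>)) / \<bar>u\<bar> ^ 3"
      by (intro divide_right_mono mult_left_mono) auto
    moreover have "\<bar>- (2 * \<eta> * (sin (u * (3*\<eta>) + \<phi>) + sin (u * \<eta> + \<phi>))) / u\<^sup>2
       - 2 * (cos (u * (3*\<eta>) + \<phi>) - cos (u * \<eta> + \<phi>)) / u ^ 3\<bar>
       \<le> 2 * \<eta> * \<bar>sin (u * (3*\<eta>) + \<phi>) + sin (u * \<eta> + \<phi>)\<bar> / u\<^sup>2
         + 2 * \<bar>cos (u * (3*\<eta>) + \<phi>) - cos (u * \<eta> + \<phi>)\<bar> / \<bar>u\<bar> ^ 3"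
      using assms by (intro order.trans[OF abs_triangle_ineq4]) (simp add: abs_mult power_abs del: right_diff_distrib_numeral)
    ultimately show ?thesis by linarith
  qed
  also have "2 * (\<bar>u\<bar> * (2 * \<eta>)) / \<bar>u\<bar> ^ 3 = 4 * \<eta> / u\<^sup>2"
    using assms by (simp add: power3_eq_cube power2_eq_square field_simps)
  finally show ?thesis by simp
qed

text \<open>The trivial and the decay bound merged into one summable majorant. Splitting at
  (\<eta>u)^2 = 6 suits the constant 10: 7 times 4/3 is less than 10, and 8 (1 + s) \<le> 10 s holds
  for s \<ge> 4.\<close>

lemma bump_sin_bound:
  assumes "\<eta> > 0"
  shows "\<bar>bump_sin \<eta> (2 * pi * u) \<phi>\<bar> \<le> 10 * \<eta> ^ 3 / (1 + (\<eta> * u)\<^sup>2)"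
proof (cases "(\<eta> * u)\<^sup>2 \<le> 6")
  case True
  have "4 / 3 * \<eta> ^ 3 * (1 + (\<eta> * u)\<^sup>2) \<le> 4 / 3 * \<eta> ^ 3 * 7"
    using True assms by (intro mult_left_mono) auto
  also have "\<dots> \<le> 10 * \<eta> ^ 3" using assms by simp
  finally have "4 / 3 * \<eta> ^ 3 * (1 + (\<eta> * u)\<^sup>2) \<le> 10 * \<eta> ^ 3" .
  moreover have "1 + (\<eta> * u)\<^sup>2 > 0" by (simp add: add_pos_nonneg)
  ultimately have "4 / 3 * \<eta> ^ 3 \<le> 10 * \<eta> ^ 3 / (1 + (\<eta> * u)\<^sup>2)"
    by (subst pos_le_divide_eq) auto
  thus ?thesis using bump_sin_trivial_bound[OF assms, of "2 * pi * u" \<phi>] by linarith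
next
  case False
  hence u: "u \<noteq> 0" by auto
  have "1\<^sup>2 \<le> (2 * pi)\<^sup>2" using pi_ge_two by (intro power_mono) auto
  hence "1 * u\<^sup>2 \<le> (2 * pi)\<^sup>2 * u\<^sup>2" by (intro mult_right_mono) auto
  hence "8 * \<eta> / (2 * pi * u)\<^sup>2 \<le> 8 * \<eta> / u\<^sup>2"
    using u assms by (intro divide_left_mono) (auto simp: power_mult_distrib)
  also have "\<dots> \<le> 10 * \<eta> ^ 3 / (1 + (\<eta> * u)\<^sup>2)"
  proof -
    have "8 * (1 + (\<eta> * u)\<^sup>2) \<le> 10 * (\<eta> * u)\<^sup>2" using False by simp
    hence "\<eta> * (8 * (1 + (\<eta> * u)\<^sup>2)) \<le> \<eta> * (10 * (\<eta> * u)\<^sup>2)" using assms by (intro mult_left_mono) auto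
    hence "8 * \<eta> * (1 + (\<eta> * u)\<^sup>2) \<le> 10 * \<eta> ^ 3 * u\<^sup>2"
      by (simp add: power_mult_distrib power3_eq_cube power2_eq_square mult_ac)
    moreover have "1 + (\<eta> * u)\<^sup>2 > 0" by (simp add: add_pos_nonneg)
    moreover have "u\<^sup>2 > 0" using u by simp
    ultimately show ?thesis by (simp add: divide_le_eq pos_le_divide_eq mult_ac)
  qed
  finally show ?thesis using bump_sin_decay_bound[OF assms, of "2 * pi * u" \<phi>] u by simp
qed

text \<open>Comparison with an integral: by the mean value theorem each term with i \<ge> 1 is at
  most an increment of arctan divided by c, and arctan stays below 2.\<close>

lemma sum_lorentz_le:
  assumes "c > 0"
  shows "(\<Sum>i<M. 1 / (1 + (c * real i)\<^sup>2)) \<le> 1 + 2 / c"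
proof -
  have "(\<Sum>i=1..M. 1 / (1 + (c * real i)\<^sup>2)) \<le> arctan (c * real M) / c" for M
  proof (induction M)
    case (Suc M)
    define x y where "x = c * real M" and "y = c * real (Suc M)"
    have xy: "0 \<le> x" "x < y" "y - x = c" using assms by (auto simp: x_def y_def algebra_simps)
    obtain z where z: "x < z" "z < y" "arctan y - arctan x = (y - x) * inverse (1 + z\<^sup>2)"
      using MVT2[OF xy(2), of arctan "\<lambda>z. inverse (1 + z\<^sup>2)"] DERIV_arctan by blast
    have "z\<^sup>2 \<le> y\<^sup>2" using z xy by (intro power_mono) auto
    hence "1 / (1 + y\<^sup>2) \<le> inverse (1 + z\<^sup>2)"
      unfolding inverse_eq_divide by (intro divide_left_mono) (auto intro!: mult_pos_pos add_pos_nonneg)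
    also have "\<dots> = (arctan y - arctan x) / c" using z xy assms by simp
    finally show ?case using Suc by (simp add: x_def y_def diff_divide_distrib)
  qed simp
  note * = this
  have "(\<Sum>i<M. 1 / (1 + (c * real i)\<^sup>2)) \<le> (\<Sum>i\<in>insert 0 {1..M}. 1 / (1 + (c * real i)\<^sup>2))"
    by (intro sum_mono2) auto
  also have "\<dots> = 1 + (\<Sum>i=1..M. 1 / (1 + (c * real i)\<^sup>2))" by simp
  also have "\<dots> \<le> 1 + arctan (c * real M) / c" using * by simp
  also have "arctan (c * real M) \<le> 2" using arctan_ubound[of "c * real M"] pi_less_4 by linarith
  hence "arctan (c * real M) / c \<le> 2 / c" using assms by (intro divide_right_mono) auto
  finally show ?thesis by simp
qed

text \<open>With M = \<open>N div d\<close>, the multiple d j is at distance at least d (M - j) from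
  N, so counting multiples backwards gives the sum of \<open>sum_lorentz_le\<close> with step \<eta>
  d.\<close>

lemma sum_abs_bump_sin_le:
  assumes "\<eta> > 0" "d \<ge> 1"
  shows "(\<Sum>n | n \<in> {1..N} \<and> d dvd n. \<bar>bump_sin \<eta> (2 * pi * real (N - n)) 0\<bar>)
    \<le> 10 * \<eta> ^ 3 + 20 * \<eta>\<^sup>2 / real d"
proof -
  define M where "M = N div d"
  have "(\<Sum>n | n \<in> {1..N} \<and> d dvd n. \<bar>bump_sin \<eta> (2 * pi * real (N - n)) 0\<bar>)
     = (\<Sum>j=1..M. \<bar>bump_sin \<eta> (2 * pi * real (N - d * j)) 0\<bar>)"
    unfolding M_def by (rule sum_multiples[OF assms(2)])
  also have "\<dots> \<le> (\<Sum>j=1..M. 10 * \<eta> ^ 3 * (1 / (1 + (\<eta> * real d * real (M - j))\<^sup>2)))"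
  proof (rule sum_mono)
    fix j assume j: "j \<in> {1..M}"
    have "d * M \<le> N" unfolding M_def by simp
    hence "d * (M - j) \<le> N - d * j" using j by (simp add: diff_mult_distrib2 diff_le_mono)
    hence "real d * real (M - j) \<le> real (N - d * j)" by (metis of_nat_le_iff of_nat_mult)
    hence "(\<eta> * (real d * real (M - j)))\<^sup>2 \<le> (\<eta> * real (N - d * j))\<^sup>2"
      using assms by (intro power_mono mult_left_mono) auto
    hence "10 * \<eta> ^ 3 / (1 + (\<eta> * real (N - d * j))\<^sup>2) \<le> 10 * \<eta> ^ 3 / (1 + (\<eta> * (real d * real (M - j)))\<^sup>2)"
      using assms by (intro divide_left_mono) (auto intro!: mult_pos_pos add_pos_nonneg)
    thus "\<bar>bump_sin \<eta> (2 * pi * real (N - d * j)) 0\<bar>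
       \<le> 10 * \<eta> ^ 3 * (1 / (1 + (\<eta> * real d * real (M - j))\<^sup>2))"
      using bump_sin_bound[OF assms(1), of "real (N - d * j)" 0] by (simp add: mult.assoc)
  qed
  also have "\<dots> = 10 * \<eta> ^ 3 * (\<Sum>i<M. 1 / (1 + (\<eta> * real d * real i)\<^sup>2))"
    unfolding sum_distrib_left[symmetric]
    by (rule arg_cong[where f = "\<lambda>s. 10 * \<eta> ^ 3 * s"],
        rule sum.reindex_bij_witness[of _ "\<lambda>i. M - i" "\<lambda>j. M - j"]) auto
  also have "\<dots> \<le> 10 * \<eta> ^ 3 * (1 + 2 / (\<eta> * real d))"
    using assms by (intro mult_left_mono sum_lorentz_le) auto
  also have "\<dots> = 10 * \<eta> ^ 3 + 20 * \<eta>\<^sup>2 / real d"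
    using assms by (simp add: field_simps power3_eq_cube power2_eq_square)
  finally show ?thesis .
qed

text \<open>The pointwise bound for the sine sums is integrated against the bump. Its oscillating
  part is harmless: since N \<eta> \<ge> 1, the decay bound makes it at most half of the integral of
  the bump.\<close>

lemma sum_bump_sin_ge:
  assumes \<eta>: "\<eta> > 0" "real N * \<eta> \<ge> 1" and d: "d \<ge> 1" "6 * pi * \<eta> * real d \<le> 1"
  shows "(\<Sum>n | n \<in> {1..N} \<and> d dvd n. bump_sin \<eta> (2 * pi * real (N - n)) 0)
    \<ge> \<eta>\<^sup>2 / (30 * real d) - 3 * \<eta> ^ 3"
proof -
  let ?I = "{\<eta>..3*\<eta>}"
  \<comment> \<open>The smallest value of 1/(2 pi d x) on the interval, attained at x =
    3\<eta>.\<close>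
  define c where "c = 1 / (6 * pi * real d * \<eta>)"
  have c: "c > 0" using \<eta> d by (simp add: c_def)
  have ic: "(\<lambda>x. bump \<eta> x * cos (2 * pi * real N * x)) integrable_on ?I"
    by (intro integrable_continuous_real continuous_intros)
  have ib: "bump \<eta> integrable_on ?I" using integral_bump[OF \<eta>(1)] by auto
  have "integral ?I (\<lambda>x. bump \<eta> x * cos (2 * pi * real N * x)) = bump_sin \<eta> (2 * pi * real N) (pi / 2)"
    unfolding bump_sin_def by (simp add: sin_add)
  also have "\<dots> \<le> 8 * \<eta> / (2 * pi * real N)\<^sup>2"
    using bump_sin_decay_bound[OF \<eta>(1), of "2 * pi * real N" "pi / 2"] \<eta> by (cases "N = 0") auto
  also have "\<dots> \<le> 2 / 3 * \<eta> ^ 3"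
  proof -
    have "real N > 0" using \<eta> by (cases "N = 0") auto
    have "1\<^sup>2 \<le> (real N * \<eta>)\<^sup>2" using \<eta> by (intro power_mono) auto
    moreover have "(2 * pi)\<^sup>2 \<ge> 4\<^sup>2" using pi_ge_two by (intro power_mono) auto
    ultimately have "(2 * pi)\<^sup>2 * (real N * \<eta>)\<^sup>2 \<ge> 4\<^sup>2 * 1\<^sup>2" by (intro mult_mono) auto
    hence "12 \<le> (2 * pi * real N)\<^sup>2 * \<eta>\<^sup>2" by (simp add: power_mult_distrib mult_ac)
    hence "\<eta> * 12 \<le> \<eta> * ((2 * pi * real N)\<^sup>2 * \<eta>\<^sup>2)" using \<eta> by (intro mult_left_mono) auto
    thus ?thesis using \<open>real N > 0\<close>
      by (simp add: divide_le_eq power2_eq_square power3_eq_cube mult_ac)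
  qed
  finally have cosb: "integral ?I (\<lambda>x. bump \<eta> x * cos (2 * pi * real N * x)) \<le> 2 / 3 * \<eta> ^ 3" .
  have "c * (4 / 3 * \<eta> ^ 3 - 2 / 3 * \<eta> ^ 3) - 2 * (4 / 3 * \<eta> ^ 3)
     \<le> c * (integral ?I (bump \<eta>) - integral ?I (\<lambda>x. bump \<eta> x * cos (2 * pi * real N * x)))
       - 2 * integral ?I (bump \<eta>)"
    unfolding integral_unique[OF integral_bump[OF \<eta>(1)]] using cosb c
    by (intro diff_right_mono mult_left_mono) auto
  also have "\<dots> = integral ?I (\<lambda>x. c * (bump \<eta> x - bump \<eta> x * cos (2 * pi * real N * x)) - 2 * bump \<eta> x)"
    using ic ib by (simp add: integral_diff integrable_diff integrable_on_mult_right)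
  also have "\<dots> \<le> integral ?I (\<lambda>x. \<Sum>n | n \<in> {1..N} \<and> d dvd n. bump \<eta> x * sin (2 * pi * real (N - n) * x + 0))"
  proof (rule integral_le)
    show "(\<lambda>x. \<Sum>n | n \<in> {1..N} \<and> d dvd n. bump \<eta> x * sin (2 * pi * real (N - n) * x + 0)) integrable_on ?I"
      by (intro integrable_sum bump_sin_integrable) auto
  next
    fix x assume x: "x \<in> ?I"
    have b: "bump \<eta> x \<ge> 0" using bump_nonneg[OF x] .
    have x0: "x > 0" using x \<eta> by auto
    have "real d * (2 * pi * x) \<le> real d * (2 * pi * (3 * \<eta>))"
      using x by (intro mult_left_mono) auto
    also have "\<dots> \<le> 1" using d by (simp add: mult_ac)
    finally have dx: "real d * (2 * pi * x) \<le> 1" .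
    have "c \<le> 1 / (real d * (2 * pi * x))"
      unfolding c_def using x x0 d \<eta> by (intro divide_left_mono) auto
    hence "c * (1 - cos (2 * pi * real N * x)) \<le> 1 / (real d * (2 * pi * x)) * (1 - cos (2 * pi * real N * x))"
      by (intro mult_right_mono) auto
    also have "\<dots> - 2 \<le> (\<Sum>n | n \<in> {1..N} \<and> d dvd n. sin (real (N - n) * (2 * pi * x)))"
      using sum_sin_multiples_ge[of d "2 * pi * x" N] d dx x0 by (simp add: mult_ac)
    finally have "c * (1 - cos (2 * pi * real N * x)) - 2
       \<le> (\<Sum>n | n \<in> {1..N} \<and> d dvd n. sin (real (N - n) * (2 * pi * x)))" by simp
    hence "bump \<eta> x * (c * (1 - cos (2 * pi * real N * x)) - 2)
       \<le> bump \<eta> x * (\<Sum>n | n \<in> {1..N} \<and> d dvd n. sin (real (N - n) * (2 * pi * x)))"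
      using b by (rule mult_left_mono)
    thus "c * (bump \<eta> x - bump \<eta> x * cos (2 * pi * real N * x)) - 2 * bump \<eta> x
       \<le> (\<Sum>n | n \<in> {1..N} \<and> d dvd n. bump \<eta> x * sin (2 * pi * real (N - n) * x + 0))"
      by (simp add: sum_distrib_left algebra_simps)
  qed (intro integrable_continuous_real continuous_intros)
  also have "\<dots> = (\<Sum>n | n \<in> {1..N} \<and> d dvd n. bump_sin \<eta> (2 * pi * real (N - n)) 0)"
    unfolding bump_sin_def by (intro integral_sum bump_sin_integrable) auto
  finally have "c * (2 / 3 * \<eta> ^ 3) - 8 / 3 * \<eta> ^ 3
     \<le> (\<Sum>n | n \<in> {1..N} \<and> d dvd n. bump_sin \<eta> (2 * pi * real (N - n)) 0)" by simp
  moreover have "c * (2 / 3 * \<eta> ^ 3) \<ge> \<eta>\<^sup>2 / (30 * real d)"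
  proof -
    have "c * (2 / 3 * \<eta> ^ 3) = \<eta>\<^sup>2 / (9 * pi * real d)"
      using \<eta> d by (simp add: c_def field_simps power3_eq_cube power2_eq_square)
    also have "\<dots> \<ge> \<eta>\<^sup>2 / (30 * real d)"
      using d pi_approx by (intro divide_left_mono mult_right_mono) auto
    finally show ?thesis .
  qed
  moreover have "\<eta> ^ 3 \<ge> 0" using \<eta> by simp
  ultimately show ?thesis by linarith
qed

text \<open>Three kinds of divisors. Primes up to sqrt N meet the size condition of
  \<open>sum_bump_sin_ge\<close> and give the main term; the larger primes and the proper prime
  powers are each O(\<eta>^2).\<close>

lemma sum_bump_sin_divisor_count_ge:
  obtains C :: real where "C > 0" "\<And>D N \<eta>. {q. prime q} \<subseteq> D \<Longrightarrow> D \<subseteq> {d. primepow d} \<Longrightarrow>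
    \<eta> > 0 \<Longrightarrow> real N * \<eta> \<ge> 1 \<Longrightarrow> 6 * pi * \<eta> * sqrt (real N) \<le> 1 \<Longrightarrow>
    (\<Sum>n=1..N. real (divisor_count D n) * bump_sin \<eta> (2 * pi * real (N - n)) 0)
      \<ge> \<eta>\<^sup>2 * (sum_inv (primes_upto (sqrt (real N))) / 30 - C)"
proof -
  obtain C1 :: real where C1: "C1 > 0"
    "\<And>N. real (card {d \<in> proper_primepows. d \<le> N}) \<le> C1 * sqrt (real N)"
    using card_proper_primepows_le by blast
  obtain C2 :: real where C2: "C2 > 0"
    "\<And>N. (\<Sum>d | d \<in> proper_primepows \<and> d \<le> N. real d powr (-3/4)) \<le> C2"
    using sum_proper_primepows_le by blast
  define C where "C = 33 + 10 * C1 + 20 * C2"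
  have main: "(\<Sum>n=1..N. real (divisor_count D n) * bump_sin \<eta> (2 * pi * real (N - n)) 0)
      \<ge> \<eta>\<^sup>2 * (sum_inv (primes_upto (sqrt (real N))) / 30 - C)"
    if D: "{q. prime q} \<subseteq> D" "D \<subseteq> {d. primepow d}"
      and \<eta>: "\<eta> > 0" "real N * \<eta> \<ge> 1" "6 * pi * \<eta> * sqrt (real N) \<le> 1" for D N \<eta>
  proof -
    define J where "J d = (\<Sum>n | n \<in> {1..N} \<and> d dvd n. bump_sin \<eta> (2 * pi * real (N - n)) 0)" for d
    define A where "A = {d. d \<in> D \<and> d \<le> N}"
    define P where "P = primes_upto (sqrt (real N))"
    define P' where "P' = {q. prime q \<and> sqrt (real N) < real q}"
    define A' where "A' = {d. d \<in> P' \<and> d \<le> N}"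
    define R where "R = {d \<in> D. d \<in> proper_primepows \<and> d \<le> N}"
    have fin: "finite P" "finite A'" "finite R" unfolding P_def A'_def R_def by auto
    have N1: "real N \<ge> 1" using \<eta> by (cases "N = 0") auto
    have sqN: "1 \<le> sqrt (real N)" "sqrt (real N) \<le> real N"
      using N1 by (auto intro!: real_le_lsqrt simp: power2_eq_square)
    have "A = P \<union> A' \<union> R"
    proof -
      have "q \<le> N" if "real q \<le> sqrt (real N)" for q :: nat
        using that sqN by linarith
      thus ?thesis using D
        by (auto simp: A_def P_def primes_upto_def A'_def P'_def R_def proper_primepows_def)
    qed
    moreover have "P \<inter> A' = {}" "(P \<union> A') \<inter> R = {}"
      by (auto simp: P_def primes_upto_def A'_def P'_def R_def proper_primepows_def)
    ultimately have split: "sum J A = sum J P + sum J A' + sum J R"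
      using fin by (simp add: sum.union_disjoint)
    have \<eta>s: "\<eta> * sqrt (real N) \<le> 1"
    proof -
      have "1 * (\<eta> * sqrt (real N)) \<le> (6 * pi) * (\<eta> * sqrt (real N))"
        using pi_ge_two \<eta> by (intro mult_right_mono) auto
      also have "\<dots> = 6 * pi * \<eta> * sqrt (real N)" by simp
      finally show ?thesis using \<eta> by linarith
    qed
    have "\<eta> * 1 \<le> \<eta> * sqrt (real N)" using \<eta> sqN by (intro mult_left_mono) auto
    hence \<eta>1: "\<eta> \<le> 1" using \<eta>s by linarith
    have "\<eta>\<^sup>2 * \<eta> \<le> \<eta>\<^sup>2 * 1" using \<eta> \<eta>1 by (intro mult_left_mono) auto
    hence \<eta>3: "\<eta> ^ 3 \<le> \<eta>\<^sup>2" by (simp add: power3_eq_cube power2_eq_square)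
    \<comment> \<open>This absorbs the error of order \<eta>^3 per divisor for the two sets of size
      O(sqrt N): the small primes and the proper prime powers.\<close>
    have "\<eta>\<^sup>2 * (\<eta> * sqrt (real N)) \<le> \<eta>\<^sup>2 * 1" using \<eta>s by (intro mult_left_mono) auto
    hence \<eta>3s: "\<eta> ^ 3 * sqrt (real N) \<le> \<eta>\<^sup>2" by (simp add: power3_eq_cube power2_eq_square mult_ac)
    have absJ: "\<bar>J d\<bar> \<le> 10 * \<eta> ^ 3 + 20 * \<eta>\<^sup>2 / real d" if "d \<ge> 1" for d
      unfolding J_def using sum_abs_bump_sin_le[OF \<eta>(1) that, of N]
      by (rule order.trans[OF sum_abs])
    have small: "sum J P \<ge> \<eta>\<^sup>2 * (sum_inv P / 30) - 3 * \<eta>\<^sup>2"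
    proof -
      have "P \<subseteq> {1..nat \<lfloor>sqrt (real N)\<rfloor>}"
        by (auto simp: P_def primes_upto_def le_nat_floor Suc_le_eq prime_gt_0_nat)
      hence "card P \<le> nat \<lfloor>sqrt (real N)\<rfloor>" using card_mono[of "{1..nat \<lfloor>sqrt (real N)\<rfloor>}" P] by simp
      hence "real (card P) \<le> sqrt (real N)" using sqN by linarith
      hence "3 * \<eta> ^ 3 * real (card P) \<le> 3 * \<eta> ^ 3 * sqrt (real N)"
        using \<eta> by (intro mult_left_mono) auto
      hence "3 * \<eta> ^ 3 * real (card P) \<le> 3 * \<eta>\<^sup>2" using \<eta>3s by simp
      moreover have "(\<Sum>d\<in>P. \<eta>\<^sup>2 / (30 * real d) - 3 * \<eta> ^ 3) = \<eta>\<^sup>2 * (sum_inv P / 30) - 3 * \<eta> ^ 3 * real (card P)"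
        by (simp add: sum_subtractf sum_inv_def sum_distrib_left sum_divide_distrib mult.commute)
      moreover have "(\<Sum>d\<in>P. \<eta>\<^sup>2 / (30 * real d) - 3 * \<eta> ^ 3) \<le> sum J P"
      proof (rule sum_mono)
        fix d assume d: "d \<in> P"
        have "6 * pi * \<eta> * real d \<le> 6 * pi * \<eta> * sqrt (real N)"
          using d \<eta> by (intro mult_left_mono) (auto simp: P_def primes_upto_def)
        hence "6 * pi * \<eta> * real d \<le> 1" using \<eta>(3) by (rule order.trans)
        moreover have "d \<ge> 1" using d by (auto simp: P_def primes_upto_def Suc_le_eq prime_gt_0_nat)
        ultimately show "\<eta>\<^sup>2 / (30 * real d) - 3 * \<eta> ^ 3 \<le> J d"
          unfolding J_def using \<eta> by (intro sum_bump_sin_ge) auto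
      qed
      ultimately show ?thesis by linarith
    qed
    \<comment> \<open>Bounding each prime separately would add \<eta>^3 too often. After returning
      to the sum over n the count is at most 1, and the estimate for d = 1 suffices.\<close>
    have large: "sum J A' \<ge> - (30 * \<eta>\<^sup>2)"
    proof -
      have "sum J A' = (\<Sum>n=1..N. real (divisor_count P' n) * bump_sin \<eta> (2 * pi * real (N - n)) 0)"
        unfolding A'_def J_def by (rule sum_divisor_count[symmetric]) (auto simp: P'_def)
      also have "\<dots> \<ge> (\<Sum>n=1..N. - \<bar>bump_sin \<eta> (2 * pi * real (N - n)) 0\<bar>)"
      proof (rule sum_mono)
        fix n assume n: "n \<in> {1..N}"
        have "divisor_count P' n \<le> 1"
        proof -
          have "q = r" if qr: "q \<in> P'" "r \<in> P'" "q dvd n" "r dvd n" for q r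
          proof (rule ccontr)
            assume "q \<noteq> r"
            hence "coprime q r" using qr by (auto simp: P'_def intro: primes_coprime)
            hence "q * r dvd n" using qr by (simp add: divides_mult)
            hence "q * r \<le> N" using n by (auto dest: dvd_imp_le)
            hence "real q * real r \<le> real N" by (metis of_nat_le_iff of_nat_mult)
            moreover have "sqrt (real N) * sqrt (real N) < real q * real r"
              using qr sqN by (intro mult_strict_mono) (auto simp: P'_def prime_gt_0_nat)
            ultimately show False by simp
          qed
          moreover have "finite {d \<in> P'. d dvd n}"
            by (rule finite_subset[of _ "{..n}"]) (use n in \<open>auto dest: dvd_imp_le\<close>)
          ultimately show ?thesis
            unfolding divisor_count_def by (simp add: card_le_Suc0_iff_eq)
        qed
        hence "real (divisor_count P' n) * \<bar>bump_sin \<eta> (2 * pi * real (N - n)) 0\<bar>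
           \<le> 1 * \<bar>bump_sin \<eta> (2 * pi * real (N - n)) 0\<bar>"
          by (intro mult_right_mono) auto
        moreover have "- (real (divisor_count P' n) * \<bar>bump_sin \<eta> (2 * pi * real (N - n)) 0\<bar>)
           \<le> real (divisor_count P' n) * bump_sin \<eta> (2 * pi * real (N - n)) 0"
          by (metis abs_ge_minus_self abs_mult abs_of_nat minus_le_iff)
        ultimately show "- \<bar>bump_sin \<eta> (2 * pi * real (N - n)) 0\<bar>
           \<le> real (divisor_count P' n) * bump_sin \<eta> (2 * pi * real (N - n)) 0" by linarith
      qed
      also have "(\<Sum>n=1..N. - \<bar>bump_sin \<eta> (2 * pi * real (N - n)) 0\<bar>) \<ge> - (10 * \<eta> ^ 3 + 20 * \<eta>\<^sup>2)"
      proof -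
        have "{n. n \<in> {1..N} \<and> 1 dvd n} = {1..N}" by auto
        thus ?thesis using sum_abs_bump_sin_le[OF \<eta>(1), of 1 N] by (simp add: sum_negf)
      qed
      finally show ?thesis using \<eta>3 by linarith
    qed
    have powers: "sum J R \<ge> - ((10 * C1 + 20 * C2) * \<eta>\<^sup>2)"
    proof -
      let ?B = "{d. d \<in> proper_primepows \<and> d \<le> N}"
      have "- sum J R \<le> (\<Sum>d\<in>R. 10 * \<eta> ^ 3 + 20 * \<eta>\<^sup>2 * real d powr (-3/4))"
        unfolding sum_negf[symmetric]
      proof (rule sum_mono)
        fix d assume "d \<in> R"
        hence d: "d \<ge> 1" by (auto simp: R_def proper_primepows_def primepow_gt_0_nat Suc_le_eq)
        have "real d powr (-1) \<le> real d powr (-3/4)" using d by (intro powr_mono) auto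
        hence "1 / real d \<le> real d powr (-3/4)" using d by (simp add: powr_minus_divide)
        hence "20 * \<eta>\<^sup>2 * (1 / real d) \<le> 20 * \<eta>\<^sup>2 * real d powr (-3/4)" by (intro mult_left_mono) auto
        thus "- J d \<le> 10 * \<eta> ^ 3 + 20 * \<eta>\<^sup>2 * real d powr (-3/4)" using absJ[OF d] by simp
      qed
      also have "\<dots> \<le> (\<Sum>d\<in>?B. 10 * \<eta> ^ 3 + 20 * \<eta>\<^sup>2 * real d powr (-3/4))"
        using \<eta> by (intro sum_mono2) (auto simp: R_def)
      also have "\<dots> = 10 * \<eta> ^ 3 * real (card ?B) + 20 * \<eta>\<^sup>2 * (\<Sum>d\<in>?B. real d powr (-3/4))"
        by (simp add: sum.distrib sum_distrib_left)
      also have "\<dots> \<le> 10 * \<eta> ^ 3 * (C1 * sqrt (real N)) + 20 * \<eta>\<^sup>2 * C2"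
        using C1(2)[of N] C2(2)[of N] \<eta> by (intro add_mono mult_left_mono) auto
      also have "10 * \<eta> ^ 3 * (C1 * sqrt (real N)) = 10 * C1 * (\<eta> ^ 3 * sqrt (real N))" by simp
      also have "\<dots> \<le> 10 * C1 * \<eta>\<^sup>2" using \<eta>3s C1 by (intro mult_left_mono) auto
      finally show ?thesis by (simp add: algebra_simps)
    qed
    have D0: "0 \<notin> D" using D by auto
    have "(\<Sum>n=1..N. real (divisor_count D n) * bump_sin \<eta> (2 * pi * real (N - n)) 0) = sum J A"
      unfolding A_def J_def by (rule sum_divisor_count[OF D0])
    also have "\<dots> \<ge> \<eta>\<^sup>2 * (sum_inv P / 30) - 3 * \<eta>\<^sup>2 - 30 * \<eta>\<^sup>2 - (10 * C1 + 20 * C2) * \<eta>\<^sup>2"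
      unfolding split using small large powers by linarith
    finally show ?thesis by (simp add: P_def C_def algebra_simps)
  qed
  moreover have "C > 0" using C1 C2 by (simp add: C_def)
  ultimately show ?thesis using that by blast
qed

text \<open>Multiplication by e(-N \<beta>) leaves the modulus unchanged and turns n into n - N; the
  sine sum is minus the imaginary part of the product.\<close>

lemma Im_exp_sum_shift:
  fixes f :: "nat \<Rightarrow> nat"
  shows "\<bar>\<Sum>n=1..N. real (f n) * sin (2 * pi * real (N - n) * \<beta>)\<bar> \<le> cmod (exp_sum (\<lambda>n. of_nat (f n)) N \<beta>)"
proof -
  define z where "z = exp (- (2 * of_real pi * \<i> * of_nat N * of_real \<beta>)) * exp_sum (\<lambda>n. of_nat (f n)) N \<beta>"
  have "z = (\<Sum>n=1..N. of_nat (f n) * exp (of_real (- (2 * pi * real (N - n) * \<beta>)) * \<i>))"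
    unfolding z_def exp_sum_def sum_distrib_left
    by (intro sum.cong refl) (simp add: exp_add[symmetric] of_nat_diff algebra_simps)
  hence "Im z = - (\<Sum>n=1..N. real (f n) * sin (2 * pi * real (N - n) * \<beta>))"
    by (simp add: Im_exp sum_negf)
  moreover have "cmod z = cmod (exp_sum (\<lambda>n. of_nat (f n)) N \<beta>)"
    by (simp add: z_def norm_mult)
  ultimately show ?thesis using abs_Im_le_cmod[of z] by simp
qed

lemma continuous_on_exp_sum [continuous_intros]: "continuous_on A (exp_sum f N)"
  unfolding exp_sum_def by (intro continuous_intros)

text \<open>Cauchy-Schwarz against the bump, obtained by integrating F^2 \<ge> 2 \<mu> b F - \<mu>^2
  b^2 with b the bump and F the sine sum. Their correlation is at least a multiple of \<eta>^2 ln ln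
  N.\<close>

lemma integral_exp_sum_near_zero_ge:
  obtains c :: real where "c > 0" "eventually (\<lambda>N. \<forall>D \<eta>. {q. prime q} \<subseteq> D \<longrightarrow> D \<subseteq> {d. primepow d} \<longrightarrow>
    \<eta> > 0 \<longrightarrow> real N * \<eta> \<ge> 1 \<longrightarrow> 6 * pi * \<eta> * sqrt (real N) \<le> 1 \<longrightarrow>
    integral {\<eta>..3*\<eta>} (\<lambda>\<beta>. (cmod (exp_sum (\<lambda>n. of_nat (divisor_count D n)) N \<beta>))\<^sup>2)
      \<ge> c * (ln (ln (real N)))\<^sup>2 / \<eta>) sequentially"
proof -
  obtain C :: real where C: "C > 0" "\<And>D N \<eta>. {q. prime q} \<subseteq> D \<Longrightarrow> D \<subseteq> {d. primepow d} \<Longrightarrow>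
    \<eta> > 0 \<Longrightarrow> real N * \<eta> \<ge> 1 \<Longrightarrow> 6 * pi * \<eta> * sqrt (real N) \<le> 1 \<Longrightarrow>
    (\<Sum>n=1..N. real (divisor_count D n) * bump_sin \<eta> (2 * pi * real (N - n)) 0)
      \<ge> \<eta>\<^sup>2 * (sum_inv (primes_upto (sqrt (real N))) / 30 - C)"
    using sum_bump_sin_divisor_count_ge by blast
  obtain b where b: "b > 0"
    "eventually (\<lambda>N. sum_inv (primes_upto (sqrt (real N))) \<ge> b * ln (ln (real N))) sequentially"
    using sum_inv_primes_sqrt_ge by blast
  have "eventually (\<lambda>N. b / 60 * ln (ln (real N)) \<ge> C) sequentially" using b(1) by real_asymp
  with b(2) have "eventually (\<lambda>N. \<forall>D \<eta>. {q. prime q} \<subseteq> D \<longrightarrow> D \<subseteq> {d. primepow d} \<longrightarrow>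
    \<eta> > 0 \<longrightarrow> real N * \<eta> \<ge> 1 \<longrightarrow> 6 * pi * \<eta> * sqrt (real N) \<le> 1 \<longrightarrow>
    integral {\<eta>..3*\<eta>} (\<lambda>\<beta>. (cmod (exp_sum (\<lambda>n. of_nat (divisor_count D n)) N \<beta>))\<^sup>2)
      \<ge> (b / 60)\<^sup>2 / 2 * (ln (ln (real N)))\<^sup>2 / \<eta>) sequentially"
  proof eventually_elim
    case (elim N)
    show ?case
    proof (intro allI impI)
      fix D :: "nat set" and \<eta> :: real
      assume D: "{q. prime q} \<subseteq> D" "D \<subseteq> {d. primepow d}"
        and \<eta>: "\<eta> > 0" "real N * \<eta> \<ge> 1" "6 * pi * \<eta> * sqrt (real N) \<le> 1"
      let ?I = "{\<eta>..3*\<eta>}"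
      define f where "f = divisor_count D"
      define F where "F x = (\<Sum>n=1..N. real (f n) * sin (2 * pi * real (N - n) * x))" for x
      \<comment> \<open>Half of the main term with coefficient b/30 pays for the constant
        \<open>C\<close>.\<close>
      define l where "l = b / 60 * ln (ln (real N))"
      \<comment> \<open>The maximiser of 2 \<mu> \<eta>^2 l - 2 \<mu>^2 \<eta>^5, where the last
        term comes from b^2 \<le> \<eta>^4 on an interval of length 2\<eta>.\<close>
      define \<mu> where "\<mu> = l / (2 * \<eta> ^ 3)"
      have l: "l > 0" using elim C unfolding l_def by linarith
      have \<mu>: "\<mu> > 0" using l \<eta> by (simp add: \<mu>_def)
      have contF: "continuous_on A F" for A unfolding F_def by (intro continuous_intros)
      have igF: "(\<lambda>x. bump \<eta> x * F x) integrable_on ?I"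
        by (intro integrable_continuous_real continuous_intros contF)
      have "\<eta>\<^sup>2 * l \<le> \<eta>\<^sup>2 * (sum_inv (primes_upto (sqrt (real N))) / 30 - C)"
        using elim by (intro mult_left_mono) (auto simp: l_def)
      also have "\<dots> \<le> (\<Sum>n=1..N. real (f n) * bump_sin \<eta> (2 * pi * real (N - n)) 0)"
        unfolding f_def by (rule C(2)[OF D \<eta>])
      also have "\<dots> = (\<Sum>n=1..N. integral ?I (\<lambda>x. real (f n) * (bump \<eta> x * sin (2 * pi * real (N - n) * x + 0))))"
        unfolding bump_sin_def by simp
      also have "\<dots> = integral ?I (\<lambda>x. \<Sum>n=1..N. real (f n) * (bump \<eta> x * sin (2 * pi * real (N - n) * x + 0)))"
        by (intro integral_sum[symmetric] integrable_on_mult_right bump_sin_integrable) auto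
      also have "\<dots> = integral ?I (\<lambda>x. bump \<eta> x * F x)"
        by (intro integral_cong) (simp add: F_def sum_distrib_left mult_ac)
      finally have B: "\<eta>\<^sup>2 * l \<le> integral ?I (\<lambda>x. bump \<eta> x * F x)" .
      have "l\<^sup>2 / (2 * \<eta>) = 2 * \<mu> * (\<eta>\<^sup>2 * l) - \<mu>\<^sup>2 * \<eta> ^ 4 * (2 * \<eta>)"
        using \<eta> by (simp add: \<mu>_def field_simps power2_eq_square power3_eq_cube power4_eq_xxxx)
      also have "\<dots> \<le> 2 * \<mu> * integral ?I (\<lambda>x. bump \<eta> x * F x) - \<mu>\<^sup>2 * \<eta> ^ 4 * (2 * \<eta>)"
        using B \<mu> by (intro diff_right_mono mult_left_mono) auto
      also have "\<dots> = integral ?I (\<lambda>x. 2 * \<mu> * (bump \<eta> x * F x) - \<mu>\<^sup>2 * \<eta> ^ 4)"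
        using \<eta> igF by (subst integral_diff) (auto intro!: integrable_on_mult_right)
      also have "\<dots> \<le> integral ?I (\<lambda>x. (cmod (exp_sum (\<lambda>n. of_nat (f n)) N x))\<^sup>2)"
      proof (rule integral_le)
        show "(\<lambda>x. 2 * \<mu> * (bump \<eta> x * F x) - \<mu>\<^sup>2 * \<eta> ^ 4) integrable_on ?I"
          by (intro integrable_continuous_real continuous_intros contF)
        show "(\<lambda>x. (cmod (exp_sum (\<lambda>n. of_nat (f n)) N x))\<^sup>2) integrable_on ?I"
          by (intro integrable_continuous_real continuous_intros)
        fix x assume x: "x \<in> ?I"
        have "(bump \<eta> x)\<^sup>2 \<le> (\<eta>\<^sup>2)\<^sup>2" using bump_nonneg[OF x] bump_le[of \<eta> x] by (intro power_mono) auto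
        hence "\<mu>\<^sup>2 * (bump \<eta> x)\<^sup>2 \<le> \<mu>\<^sup>2 * \<eta> ^ 4" by (intro mult_left_mono) auto
        moreover have "(F x - \<mu> * bump \<eta> x)\<^sup>2 \<ge> 0" by simp
        hence "(F x)\<^sup>2 \<ge> 2 * \<mu> * (bump \<eta> x * F x) - \<mu>\<^sup>2 * (bump \<eta> x)\<^sup>2"
          by (simp add: power2_eq_square algebra_simps)
        moreover have "\<bar>F x\<bar>\<^sup>2 \<le> (cmod (exp_sum (\<lambda>n. of_nat (f n)) N x))\<^sup>2"
          unfolding F_def by (intro power_mono Im_exp_sum_shift) auto
        ultimately show "2 * \<mu> * (bump \<eta> x * F x) - \<mu>\<^sup>2 * \<eta> ^ 4 \<le> (cmod (exp_sum (\<lambda>n. of_nat (f n)) N x))\<^sup>2"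
          by simp
      qed
      finally show "integral ?I (\<lambda>\<beta>. (cmod (exp_sum (\<lambda>n. of_nat (divisor_count D n)) N \<beta>))\<^sup>2)
         \<ge> (b / 60)\<^sup>2 / 2 * (ln (ln (real N)))\<^sup>2 / \<eta>"
        by (simp add: l_def f_def power_mult_distrib power_divide)
    qed
  qed
  thus ?thesis using that[of "(b / 60)\<^sup>2 / 2"] b(1) by simp
qed

subsection \<open>Minor arcs\<close>

lemma major_arcs_borel: "major_arcs K Q0 Q \<in> sets borel"
proof -
  have "major_arcs K Q0 Q = (\<Union>q\<in>{q::nat. q > 0 \<and> real q \<le> K * Q0}. \<Union>a\<in>{a. coprime a (int q)}.
     {\<theta>. \<bar>\<theta> - of_int a / real q\<bar> \<le> K / (real q * Q)})"
    unfolding major_arcs_def by blast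
  also have "\<dots> \<in> sets borel"
    by (intro sets.countable_UN'' countableI_type borel_closed closed_Collect_le continuous_intros)
  finally show ?thesis .
qed

text \<open>The link between the gauge integrals over compact intervals, in which the lower bounds
  are proved, and the Lebesgue integral defining \<open>minor_arc_integral\<close>.\<close>

lemma sum_integrals_le_minor_arc_integral:
  fixes f :: "nat \<Rightarrow> complex"
  assumes "finite I" "disjoint_family_on (\<lambda>i. {l i..u i}) I"
    and "\<And>i. i \<in> I \<Longrightarrow> {l i..u i} \<subseteq> minor_arcs K Q0 Q \<inter> {0..<1}"
  shows "(\<Sum>i\<in>I. integral {l i..u i} (\<lambda>\<theta>. (cmod (exp_sum f N \<theta>))\<^sup>2)) \<le> minor_arc_integral f N K Q0 Q"
proof -
  let ?h = "\<lambda>\<theta>. (cmod (exp_sum f N \<theta>))\<^sup>2"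
  have cont: "continuous_on A ?h" for A by (intro continuous_intros)
  have int: "set_integrable lborel {a..b} ?h" for a b
    by (rule borel_integrable_atLeastAtMost'[OF cont])
  let ?M = "minor_arcs K Q0 Q \<inter> {0..<1}"
  have M: "?M \<in> sets lborel" using major_arcs_borel by (auto simp: minor_arcs_def)
  have intM: "set_integrable lborel ?M ?h"
    by (rule set_integrable_subset[OF int[of 0 1] M]) auto
  have intU: "set_integrable lborel (\<Union>i\<in>I. {l i..u i}) ?h"
    using assms(1,3) by (intro set_integrable_subset[OF intM]) auto
  have "(\<Sum>i\<in>I. integral {l i..u i} ?h) = (\<Sum>i\<in>I. LINT \<theta>:{l i..u i}|lborel. ?h \<theta>)"
    using set_borel_integral_eq_integral(2)[OF int] by simp
  also have "\<dots> = (LINT \<theta>:(\<Union>i\<in>I. {l i..u i})|lborel. ?h \<theta>)"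
    using assms(1,2) int by (intro set_integral_finite_Union[symmetric]) auto
  also have "\<dots> \<le> (LINT \<theta>:?M|lborel. ?h \<theta>)"
    unfolding set_lebesgue_integral_def
  proof (rule integral_mono)
    fix \<theta> :: real
    have "indicator (\<Union>i\<in>I. {l i..u i}) \<theta> \<le> (indicator ?M \<theta> :: real)"
      using assms(3) by (intro indicator_leI) blast
    thus "indicator (\<Union>i\<in>I. {l i..u i}) \<theta> *\<^sub>R ?h \<theta> \<le> indicator ?M \<theta> *\<^sub>R ?h \<theta>"
      by (intro scaleR_right_mono) auto
  qed (use intU intM in \<open>auto simp: set_integrable_def\<close>)
  finally show ?thesis unfolding minor_arc_integral_def .
qed

text \<open>A fraction \<open>b/q \<noteq> a/p\<close> with \<open>q \<le> K Q0\<close> is at distance at least \<open>1/(p q)\<close> from \<open>a/p\<close>, far more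
  than \<open>t\<close> and the width of its arc; the arc around \<open>a/p\<close> itself, if there is one, has width less than \<open>t\<close>.\<close>

lemma shifted_fraction_in_minor_arcs:
  assumes p: "prime p" "1 \<le> a" "a < p" and KQ: "K > 0" "Q > 0" and t: "0 \<le> t" "t > K / (real p * Q)"
    and far: "real p * (K * Q0 * t + K / Q) < 1"
  shows "real a / real p + t \<in> minor_arcs K Q0 Q"
proof (rule ccontr)
  assume "\<not> ?thesis"
  then obtain q :: nat and b :: int where qb: "q > 0" "real q \<le> K * Q0" "coprime b (int q)"
      "\<bar>real a / real p + t - of_int b / real q\<bar> \<le> K / (real q * Q)"
    by (auto simp: minor_arcs_def major_arcs_def)
  have p0: "real p > 0" using p by (simp add: prime_gt_0_nat)
  show False
  proof (cases "int a * int q = b * int p")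
    \<comment> \<open>Here b/q = a/p. As b and q are coprime, q divides p; q = 1 is excluded by 0 <
      a < p, and for q = p the arc has radius less than t.\<close>
    case True
    hence "int q dvd b * int p" by (metis dvd_triv_right)
    hence "int q dvd int p" using qb(3) by (simp add: coprime_commute coprime_dvd_mult_right_iff)
    hence "q = 1 \<or> q = p" using p(1) by (simp add: prime_nat_iff)
    thus False
    proof
      assume "q = 1"
      hence "int p dvd int a" using True by simp
      thus False using p by (simp add: nat_dvd_not_less)
    next
      assume "q = p"
      moreover from this have "of_int b = real a" using True p0 by auto
      ultimately show False using qb(4) t by simp
    qed
  next
    case False
    hence "1 \<le> \<bar>int a * int q - b * int p\<bar>" by linarith
    hence "(of_int 1 :: real) \<le> of_int \<bar>int a * int q - b * int p\<bar>" by (simp only: of_int_le_iff)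
    hence "1 \<le> \<bar>real a * real q - of_int b * real p\<bar>" by simp
    also have "real a * real q - of_int b * real p = (real a / real p - of_int b / real q) * (real p * real q)"
      using p0 qb by (simp add: field_simps)
    also have "\<bar>\<dots>\<bar> = \<bar>real a / real p - of_int b / real q\<bar> * (real p * real q)"
      by (simp add: abs_mult)
    also have "\<dots> \<le> (t + K / (real q * Q)) * (real p * real q)"
      using qb(4) t by (intro mult_right_mono) auto
    also have "\<dots> = real p * (real q * t + K / Q)"
      using qb KQ by (simp add: field_simps)
    also have "\<dots> \<le> real p * (K * Q0 * t + K / Q)"
      using qb t by (intro mult_left_mono add_right_mono mult_right_mono) auto
    finally show False using far by simp
  qed
qed

text \<open>The case of the fraction 0: a numerator b \<noteq> 0 puts b/q at distance at least 1/q
  from 0, while b = 0 forces q = 1, whose arc around 0 has radius K/Q.\<close>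

lemma near_zero_in_minor_arcs:
  assumes KQ: "K > 0" "Q > 0" and \<beta>: "\<beta> > K / Q" and far: "K * Q0 * \<beta> + K / Q < 1"
  shows "\<beta> \<in> minor_arcs K Q0 Q"
proof (rule ccontr)
  assume "\<not> ?thesis"
  then obtain q :: nat and b :: int where qb: "q > 0" "real q \<le> K * Q0" "coprime b (int q)"
      "\<bar>\<beta> - of_int b / real q\<bar> \<le> K / (real q * Q)"
    by (auto simp: minor_arcs_def major_arcs_def)
  have \<beta>0: "\<beta> > 0" using KQ \<beta> by (meson divide_pos_pos less_trans)
  show False
  proof (cases "b = 0")
    case True
    hence "q = 1" using qb(3) by simp
    thus False using True qb(4) \<beta> by simp
  next
    case False
    hence "1 \<le> \<bar>of_int b :: real\<bar>" by linarith
    also have "\<bar>of_int b :: real\<bar> = \<bar>of_int b / real q\<bar> * real q" using qb by simp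
    also have "\<dots> \<le> (\<beta> + K / (real q * Q)) * real q"
      using qb(4) \<beta>0 by (intro mult_right_mono) auto
    also have "\<dots> = real q * \<beta> + K / Q" using qb KQ by (simp add: field_simps)
    also have "\<dots> \<le> K * Q0 * \<beta> + K / Q"
      using qb \<beta>0 by (intro add_right_mono mult_right_mono) auto
    finally show False using far by simp
  qed
qed

text \<open>Each p contributes N^2/(100p) on intervals of length 1/(100N). The condition p > 100KN/Q
  keeps these clear of the arc around a/p, the condition after it clear of all others.\<close>

lemma minor_arc_integral_ge_near_fractions:
  "eventually (\<lambda>N. \<forall>D P K Q Q0. {q. prime q} \<subseteq> D \<longrightarrow> D \<subseteq> {d. primepow d} \<longrightarrow>
     K > 0 \<longrightarrow> Q > 0 \<longrightarrow> Q0 \<ge> 0 \<longrightarrow> finite P \<longrightarrow>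
     (\<forall>p\<in>P. prime p \<and> 1000 \<le> p \<and> real p \<le> sqrt (real N) \<and> 100 * K * real N / Q < real p \<and>
        real p * (K * Q0 / real N + K / Q) < 1) \<longrightarrow>
     minor_arc_integral (\<lambda>n. of_nat (divisor_count D n)) N K Q0 Q \<ge> real N / 10000 * sum_inv P) sequentially"
  using sum_norm_exp_sum_shifts_ge eventually_gt_at_top[of 0]
proof eventually_elim
  case (elim N)
  show ?case
  proof (intro allI impI)
    fix D P :: "nat set" and K Q Q0 :: real
    assume D: "{q. prime q} \<subseteq> D" "D \<subseteq> {d. primepow d}" and KQ: "K > 0" "Q > 0" "Q0 \<ge> 0"
      and finP: "finite P" and P': "\<forall>p\<in>P. prime p \<and> 1000 \<le> p \<and> real p \<le> sqrt (real N) \<and>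
        100 * K * real N / Q < real p \<and> real p * (K * Q0 / real N + K / Q) < 1"
    define t1 t2 where "t1 = 1 / (100 * real N)" and "t2 = 1 / (50 * real N)"
    have N0: "real N > 0" using elim by simp
    have t12: "0 < t1" "t1 \<le> t2" "t2 - t1 = 1 / (100 * real N)" "t2 < 1 / real N"
      using N0 by (simp_all add: t1_def t2_def field_simps)
    define h where "h \<theta> = (cmod (exp_sum (\<lambda>n. of_nat (divisor_count D n)) N \<theta>))\<^sup>2" for \<theta>
    have cont: "continuous_on A h" for A unfolding h_def by (intro continuous_intros)
    define I where "I = (SIGMA p:P. {1..<p})"
    define x where "x = (\<lambda>(p, a). real a / real p)"
    have inI: "prime p" "1 \<le> a" "a < p" "real p > 0" "real p \<le> sqrt (real N)" if "(p, a) \<in> I" for p a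
      using that P' by (auto simp: I_def prime_gt_0_nat)
    have pp: "real p * real p' \<le> real N" if "real p \<le> sqrt (real N)" "real p' \<le> sqrt (real N)" for p p' :: nat
    proof -
      have "real p * real p' \<le> sqrt (real N) * sqrt (real N)" using that by (intro mult_mono) auto
      thus ?thesis by simp
    qed
    \<comment> \<open>Distinct fractions with prime denominators up to sqrt N differ by at least
      1/(p p') \<ge> 1/N, more than the length of the intervals, which are therefore
      disjoint.\<close>
    have sep: "\<bar>x i - x j\<bar> \<ge> 1 / real N" if ij: "i \<in> I" "j \<in> I" "i \<noteq> j" for i j
    proof -
      obtain p a p' a' where eq: "i = (p, a)" "j = (p', a')" by (cases i, cases j) auto
      note ia = inI[OF ij(1)[unfolded eq]] and ja = inI[OF ij(2)[unfolded eq]]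
      have "a * p' \<noteq> a' * p"
      proof
        assume *: "a * p' = a' * p"
        show False
        proof (cases "p = p'")
          case True
          thus False using * eq ij(3) ja by simp
        next
          case False
          hence "coprime p p'" using ia ja by (simp add: primes_coprime)
          moreover have "p dvd a * p'" using * by simp
          ultimately have "p dvd a" by (simp add: coprime_dvd_mult_left_iff)
          thus False using ia by (simp add: nat_dvd_not_less)
        qed
      qed
      hence "1 \<le> \<bar>int (a * p') - int (a' * p)\<bar>" by linarith
      hence "(of_int 1 :: real) \<le> of_int \<bar>int (a * p') - int (a' * p)\<bar>" by (simp only: of_int_le_iff)
      hence "1 \<le> \<bar>real a * real p' - real a' * real p\<bar>" by simp
      also have "real a * real p' - real a' * real p = (x i - x j) * (real p * real p')"
        using ia ja by (simp add: x_def eq field_simps)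
      also have "\<bar>\<dots>\<bar> = \<bar>x i - x j\<bar> * (real p * real p')" by (simp add: abs_mult)
      also have "\<dots> \<le> \<bar>x i - x j\<bar> * real N"
        using ia ja by (intro mult_left_mono pp) auto
      finally show ?thesis using N0 by (simp add: field_simps)
    qed
    have sub: "{x i + t1..x i + t2} \<subseteq> minor_arcs K Q0 Q \<inter> {0..<1}" if "i \<in> I" for i
    proof
      fix \<theta> assume \<theta>: "\<theta> \<in> {x i + t1..x i + t2}"
      obtain p a where eq: "i = (p, a)" by (cases i) auto
      note ia = inI[OF that[unfolded eq]]
      have pP: "100 * K * real N / Q < real p" "real p * (K * Q0 / real N + K / Q) < 1"
        using that P' by (auto simp: eq I_def)
      define t where "t = \<theta> - x i"
      have t: "t1 \<le> t" "t \<le> t2" using \<theta> by (auto simp: t_def)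
      have "\<theta> = real a / real p + t" by (simp add: t_def eq x_def)
      also have "\<dots> \<in> minor_arcs K Q0 Q"
      proof (rule shifted_fraction_in_minor_arcs)
        show "t > K / (real p * Q)"
        proof -
          have "K / (real p * Q) < t1" using pP(1) ia N0 KQ by (simp add: t1_def field_simps)
          thus ?thesis using t by linarith
        qed
        have "K * Q0 * t \<le> K * Q0 * (1 / real N)" using t t12 KQ by (intro mult_left_mono) auto
        hence "real p * (K * Q0 * t + K / Q) \<le> real p * (K * Q0 / real N + K / Q)"
          by (intro mult_left_mono) auto
        thus "real p * (K * Q0 * t + K / Q) < 1" using pP(2) by linarith
      qed (use ia KQ t t12 in auto)
      finally have "\<theta> \<in> minor_arcs K Q0 Q" .
      \<comment> \<open>Even a = p - 1 leaves the room 1/p \<ge> 1/N below 1, and t is smaller than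
        that.\<close>
      moreover have "\<theta> < 1"
      proof -
        have "real p * 1 \<le> real p * real p" using ia by (intro mult_left_mono) auto
        hence "real p \<le> real N" using pp[of p p] ia by linarith
        hence "1 / real N \<le> 1 / real p" using ia N0 by (intro divide_left_mono) auto
        moreover have "real a / real p \<le> (real p - 1) / real p" using ia by (intro divide_right_mono) auto
        moreover have "(real p - 1) / real p = 1 - 1 / real p" using ia by (simp add: field_simps)
        ultimately show ?thesis using t t12 by (simp add: t_def eq x_def)
      qed
      moreover have "\<theta> \<ge> 0"
      proof -
        have "x i \<ge> 0" by (simp add: eq x_def)
        thus ?thesis using t t12 by (simp add: t_def)
      qed
      ultimately show "\<theta> \<in> minor_arcs K Q0 Q \<inter> {0..<1}" by simp
    qed
    have fi: "finite I" unfolding I_def using finP by auto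
    have "real N / 10000 * sum_inv P = (\<Sum>p\<in>P. (1 / (100 * real N)) * ((real N)\<^sup>2 / (100 * real p)))"
      using N0 by (simp add: sum_inv_def sum_distrib_left power2_eq_square)
    also have "\<dots> \<le> (\<Sum>p\<in>P. \<Sum>a=1..<p. integral {real a / real p + t1..real a / real p + t2} h)"
    proof (rule sum_mono)
      fix p assume p: "p \<in> P"
      have shift: "integral {real a / real p + t1..real a / real p + t2} h = integral {t1..t2} (\<lambda>t. h (real a / real p + t))" for a
        using integral_shift[of t1 "real a / real p" t2 h, OF cont] by (simp add: o_def add.commute)
      have ih: "(\<lambda>t. h (real a / real p + t)) integrable_on {t1..t2}" for a
        by (intro integrable_continuous_real continuous_on_compose2[OF cont[of UNIV]] continuous_intros) auto
      have "(1 / (100 * real N)) * ((real N)\<^sup>2 / (100 * real p)) = integral {t1..t2} (\<lambda>t. (real N)\<^sup>2 / (100 * real p))"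
        using t12 by simp
      also have "\<dots> \<le> integral {t1..t2} (\<lambda>t. \<Sum>a=1..<p. h (real a / real p + t))"
      proof (rule integral_le)
        show "(\<lambda>t. \<Sum>a=1..<p. h (real a / real p + t)) integrable_on {t1..t2}"
          by (intro integrable_sum ih) auto
        fix t assume "t \<in> {t1..t2}"
        thus "(real N)\<^sup>2 / (100 * real p) \<le> (\<Sum>a=1..<p. h (real a / real p + t))"
          unfolding h_def using P' p t12
          by (intro elim(1)[rule_format, OF D]) (auto simp: t2_def)
      qed auto
      also have "\<dots> = (\<Sum>a=1..<p. integral {real a / real p + t1..real a / real p + t2} h)"
        unfolding shift by (intro integral_sum ih) auto
      finally show "(1 / (100 * real N)) * ((real N)\<^sup>2 / (100 * real p))
         \<le> (\<Sum>a=1..<p. integral {real a / real p + t1..real a / real p + t2} h)" .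
    qed
    also have "\<dots> = (\<Sum>i\<in>I. integral {x i + t1..x i + t2} h)"
      unfolding I_def x_def using finP by (subst sum.Sigma) (auto intro!: sum.cong)
    also have "\<dots> \<le> minor_arc_integral (\<lambda>n. of_nat (divisor_count D n)) N K Q0 Q"
      unfolding h_def
    proof (rule sum_integrals_le_minor_arc_integral[OF fi _ sub])
      show "disjoint_family_on (\<lambda>i. {x i + t1..x i + t2}) I"
        unfolding disjoint_family_on_def
      proof (intro ballI impI)
        fix i j assume ij: "i \<in> I" "j \<in> I" "i \<noteq> j"
        show "{x i + t1..x i + t2} \<inter> {x j + t1..x j + t2} = {}"
        proof (rule ccontr)
          assume "\<not> ?thesis"
          then obtain \<theta> where "\<theta> \<in> {x i + t1..x i + t2}" "\<theta> \<in> {x j + t1..x j + t2}" by blast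
          hence "\<bar>x i - x j\<bar> \<le> t2 - t1" by auto
          thus False using sep[OF ij] t12 by linarith
        qed
      qed
    qed
    finally show "minor_arc_integral (\<lambda>n. of_nat (divisor_count D n)) N K Q0 Q \<ge> real N / 10000 * sum_inv P" .
  qed
qed

text \<open>The interval from 2K/Q to 6K/Q avoids the arc around 0, and 1/\<eta> = Q/(2K) produces
  the factor Q/K. As K, Q and Q0 are quantified inside \<open>eventually\<close>, the threshold for
  N is uniform in them.\<close>

lemma minor_arc_integral_ge_near_zero:
  obtains c :: real where "c > 0"
    "eventually (\<lambda>N. \<forall>D K Q Q0. {q. prime q} \<subseteq> D \<longrightarrow> D \<subseteq> {d. primepow d} \<longrightarrow>
     K \<ge> 1 \<longrightarrow> Q > 0 \<longrightarrow> Q \<le> real N \<longrightarrow> K * sqrt (real N * ln (real N)) \<le> Q \<longrightarrow>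
     K * Q0 \<le> sqrt (real N) \<longrightarrow>
     minor_arc_integral (\<lambda>n. of_nat (divisor_count D n)) N K Q0 Q
       \<ge> c / K * (Q * (ln (ln (real N)))\<^sup>2)) sequentially"
proof -
  obtain c :: real where c: "c > 0" "eventually (\<lambda>N. \<forall>D \<eta>. {q. prime q} \<subseteq> D \<longrightarrow> D \<subseteq> {d. primepow d} \<longrightarrow>
    \<eta> > 0 \<longrightarrow> real N * \<eta> \<ge> 1 \<longrightarrow> 6 * pi * \<eta> * sqrt (real N) \<le> 1 \<longrightarrow>
    integral {\<eta>..3*\<eta>} (\<lambda>\<beta>. (cmod (exp_sum (\<lambda>n. of_nat (divisor_count D n)) N \<beta>))\<^sup>2)
      \<ge> c * (ln (ln (real N)))\<^sup>2 / \<eta>) sequentially"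
    using integral_exp_sum_near_zero_ge by blast
  \<comment> \<open>sqrt 2500 = 50 gives K sqrt N / Q \<le> 1/50, small enough for 12 pi / 50 \<le>
    1 and for staying away from the other arcs.\<close>
  have "eventually (\<lambda>N. ln (real N) \<ge> 2500) sequentially" by real_asymp
  with c(2) have "eventually (\<lambda>N. \<forall>D K Q Q0. {q. prime q} \<subseteq> D \<longrightarrow> D \<subseteq> {d. primepow d} \<longrightarrow>
     K \<ge> 1 \<longrightarrow> Q > 0 \<longrightarrow> Q \<le> real N \<longrightarrow> K * sqrt (real N * ln (real N)) \<le> Q \<longrightarrow>
     K * Q0 \<le> sqrt (real N) \<longrightarrow>
     minor_arc_integral (\<lambda>n. of_nat (divisor_count D n)) N K Q0 Q
       \<ge> (c / 2) / K * (Q * (ln (ln (real N)))\<^sup>2)) sequentially"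
  proof eventually_elim
    case (elim N)
    show ?case
    proof (intro allI impI)
      fix D :: "nat set" and K Q Q0 :: real
      assume D: "{q. prime q} \<subseteq> D" "D \<subseteq> {d. primepow d}"
        and K: "K \<ge> 1" and Q: "Q > 0" "Q \<le> real N" "K * sqrt (real N * ln (real N)) \<le> Q"
        and Q0: "K * Q0 \<le> sqrt (real N)"
      define \<eta> where "\<eta> = 2 * K / Q"
      have \<eta>: "\<eta> > 0" using K Q by (simp add: \<eta>_def)
      have N1: "sqrt (real N) \<ge> 1" using elim by (cases "N = 0") auto
      have "50 = sqrt (50\<^sup>2 :: real)" by (simp only: real_sqrt_abs)
      also have "\<dots> \<le> sqrt (ln (real N))" using elim by (intro real_sqrt_le_mono) simp
      finally have s50: "sqrt (ln (real N)) \<ge> 50" .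
      have "K * (sqrt (real N) * 50) \<le> K * (sqrt (real N) * sqrt (ln (real N)))"
        using s50 K by (intro mult_left_mono) auto
      also have "\<dots> \<le> Q" using Q by (simp add: real_sqrt_mult)
      finally have KQ: "K * sqrt (real N) / Q \<le> 1 / 50" using Q by (simp add: field_simps)
      have "K / Q * 1 \<le> K / Q * sqrt (real N)" using N1 K Q by (intro mult_left_mono) auto
      also have "\<dots> \<le> 1 / 50" using KQ by simp
      finally have KQ': "K / Q \<le> 1 / 50" by simp
      have "6 * pi * \<eta> * sqrt (real N) = 12 * pi * (K * sqrt (real N) / Q)" by (simp add: \<eta>_def)
      also have "\<dots> \<le> 12 * pi * (1 / 50)" using KQ by (intro mult_left_mono) auto
      also have "\<dots> \<le> 1" using pi_less_4 by simp
      finally have 1: "6 * pi * \<eta> * sqrt (real N) \<le> 1" .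
      have "Q * 1 \<le> real N * (2 * K)" using Q K by (intro mult_mono) auto
      hence 2: "real N * \<eta> \<ge> 1" using Q by (simp add: \<eta>_def field_simps)
      have sub: "{\<eta>..3*\<eta>} \<subseteq> minor_arcs K Q0 Q \<inter> {0..<1}"
      proof
        fix \<beta> assume \<beta>: "\<beta> \<in> {\<eta>..3*\<eta>}"
        have b0: "0 \<le> \<beta>" using \<beta> \<eta> by simp
        have b6: "\<beta> \<le> 6 * (K / Q)" using \<beta> by (simp add: \<eta>_def)
        have "\<beta> \<in> minor_arcs K Q0 Q"
        proof (rule near_zero_in_minor_arcs)
          have "K / Q < 2 * K / Q" using K Q by (simp add: divide_strict_right_mono)
          thus "K / Q < \<beta>" using \<beta> by (simp add: \<eta>_def)
          have "K * Q0 * \<beta> \<le> sqrt (real N) * (6 * (K / Q))" using Q0 b0 b6 by (intro mult_mono) auto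
          also have "\<dots> = 6 * (K * sqrt (real N) / Q)" by simp
          finally show "K * Q0 * \<beta> + K / Q < 1" using KQ KQ' by linarith
        qed (use K Q in auto)
        thus "\<beta> \<in> minor_arcs K Q0 Q \<inter> {0..<1}" using b0 b6 KQ' by simp
      qed
      have "(c / 2) / K * (Q * (ln (ln (real N)))\<^sup>2) = c * (ln (ln (real N)))\<^sup>2 / \<eta>"
        using K Q by (simp add: \<eta>_def field_simps)
      also have "\<dots> \<le> integral {\<eta>..3*\<eta>} (\<lambda>\<beta>. (cmod (exp_sum (\<lambda>n. of_nat (divisor_count D n)) N \<beta>))\<^sup>2)"
        using elim(1) D \<eta> 1 2 by blast
      also have "\<dots> \<le> minor_arc_integral (\<lambda>n. of_nat (divisor_count D n)) N K Q0 Q"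
        using sum_integrals_le_minor_arc_integral[of "{()}" "\<lambda>_. \<eta>" "\<lambda>_. 3 * \<eta>" K Q0 Q] sub
        by (simp add: disjoint_family_on_def)
      finally show "minor_arc_integral (\<lambda>n. of_nat (divisor_count D n)) N K Q0 Q
         \<ge> (c / 2) / K * (Q * (ln (ln (real N)))\<^sup>2)" .
    qed
  qed
  thus ?thesis using that[of "c / 2"] c(1) by simp
qed


section \<open>Comparison of the logarithmic factors and conclusion\<close>

text \<open>To be applied with r = N/Q, B = 100K and y the lower end of the range of primes.
  Constants are absorbed because ln(2r) \<ge> ln 2; the factor 2 keeps this true at Q = N.\<close>

lemma ln_ratio_le:
  fixes Y B r y :: real
  assumes "Y > 1" "B \<ge> 2" and r: "r \<ge> 1" and y: "y > 1" "y = Y \<or> y = B / 2 * (2 * r)"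
  shows "ln y \<le> (1 + (ln B + ln Y) / ln 2) * ln (2 * r)"
proof -
  have u: "ln (2 * r) \<ge> ln 2" using r by (intro ln_mono) auto
  have pos: "ln 2 > (0::real)" "ln Y > 0" "ln B > 0" using assms by auto
  have ge: "c / ln 2 * ln (2 * r) \<ge> c" if "c \<ge> 0" for c :: real
  proof -
    have "c / ln 2 * ln 2 \<le> c / ln 2 * ln (2 * r)" using that u by (intro mult_left_mono) auto
    thus ?thesis by simp
  qed
  have "ln y \<le> ln Y + ln B + ln (2 * r)"
  proof (cases "y = Y")
    case True
    hence "ln y = ln Y" by simp
    thus ?thesis using pos u by linarith
  next
    case False
    hence "y = B / 2 * (2 * r)" using y by simp
    hence "ln y = ln (B / 2) + ln (2 * r)" using assms by (simp only: ln_mult) (simp add: ln_mult ln_div)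
    also have "ln (B / 2) \<le> ln B" using assms by (intro ln_mono) auto
    finally show ?thesis using pos by simp
  qed
  also have "ln Y + ln B \<le> (ln B + ln Y) / ln 2 * ln (2 * r)"
    using ge[of "ln B + ln Y"] pos by simp
  finally show ?thesis by (simp add: algebra_simps)
qed

text \<open>Replacing y by u enlarges the quotient by a factor of at most 4C. After the logarithm
  this is an additive constant, absorbed because \<alpha>L/y \<ge> 1 + \<epsilon> keeps
  ln(\<alpha>L/y) away from 0.\<close>

lemma ln_ln_ratio_le:
  fixes \<epsilon> \<alpha> C L y u :: real
  assumes eps: "\<epsilon> > 0" and \<alpha>: "\<alpha> \<ge> 1 / 4" and C: "C \<ge> 1"
    and pos: "L > 0" "y > 0" "u > 0"
    and y: "y * (1 + \<epsilon>) \<le> \<alpha> * L" "y \<le> C * u"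
  shows "ln (L / u) \<le> (1 + ln (4 * C) / ln (1 + \<epsilon>)) * ln (\<alpha> * L / y)"
proof -
  have \<rho>: "ln (1 + \<epsilon>) > 0" using eps by simp
  have "1 + \<epsilon> \<le> \<alpha> * L / y" using y pos by (simp add: field_simps)
  hence R: "ln (1 + \<epsilon>) \<le> ln (\<alpha> * L / y)" using eps by (intro ln_mono) auto
  have "L * y \<le> L * (C * u)" using y pos by (intro mult_left_mono) auto
  also have "\<dots> = 1 * (L * (C * u))" by simp
  also have "\<dots> \<le> (4 * \<alpha>) * (L * (C * u))"
    using \<alpha> pos C by (intro mult_right_mono) auto
  finally have "L / u \<le> (4 * C) * (\<alpha> * L / y)" using pos by (simp add: field_simps)
  hence "ln (L / u) \<le> ln ((4 * C) * (\<alpha> * L / y))" using pos by (intro ln_mono) auto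
  also have "\<dots> = ln (4 * C) + ln (\<alpha> * L / y)"
    using C \<alpha> pos by (subst ln_mult) auto
  also have "ln (4 * C) = ln (4 * C) / ln (1 + \<epsilon>) * ln (1 + \<epsilon>)" using \<rho> by simp
  also have "\<dots> \<le> ln (4 * C) / ln (1 + \<epsilon>) * ln (\<alpha> * L / y)"
    using R \<rho> C by (intro mult_left_mono divide_nonneg_pos) auto
  finally show ?thesis by (simp add: algebra_simps)
qed

text \<open>The primes run from \<open>y\<close>, the larger of Y and 100KN/Q, to \<open>x\<close> =
  N^(1/2 - \<delta>/4). The bound on K Q0 keeps y below N^(1/2 - \<delta>/2), a fixed power lower.
  Averaging the resulting bound with the one near 0 gives the claim.\<close>

lemma minor_arc_integral_divisor_count_ge:
  assumes \<delta>: "0 < \<delta>" "\<delta> < 1 / 2"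
  obtains N0 :: nat where "\<And>K. K \<ge> 10 \<Longrightarrow> \<exists>\<kappa>>0. \<forall>N Q Q0 D.
    {q. prime q} \<subseteq> D \<longrightarrow> D \<subseteq> {d. primepow d} \<longrightarrow> N \<ge> N0 \<longrightarrow> Q \<le> real N \<longrightarrow>
    K * sqrt (real N * ln (real N)) \<le> Q \<longrightarrow> real N * ln (real N) / Q \<le> Q0 \<longrightarrow>
    K * Q0 < real N powr (1/2 - \<delta>/2) \<longrightarrow>
    minor_arc_integral (\<lambda>n. of_nat (divisor_count D n)) N K Q0 Q
      \<ge> \<kappa> * (Q * (ln (ln (real N)))\<^sup>2 + real N * ln (ln (real N) / ln (2 * real N / Q)))"
proof -
  \<comment> \<open>With this choice (1/2 - \<delta>/2)(1 + \<epsilon>) \<le> 1/2 - \<delta>/4,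
    hence y^(1+\<epsilon>) \<le> x.\<close>
  define \<epsilon> where "\<epsilon> = \<delta> / 4"
  have \<epsilon>: "\<epsilon> > 0" using \<delta> by (simp add: \<epsilon>_def)
  obtain c3 Y where c3: "c3 > 0" "Y > 1"
    "\<And>x y. y \<ge> Y \<Longrightarrow> x \<ge> y powr (1 + \<epsilon>) \<Longrightarrow>
       sum_inv (primes_between y x) \<ge> c3 * ln (ln x / ln y)"
    using sum_inv_primes_between_ge[OF \<epsilon>] by blast
  obtain c1 :: real where c1: "c1 > 0"
    "eventually (\<lambda>N. \<forall>D K Q Q0. {q. prime q} \<subseteq> D \<longrightarrow> D \<subseteq> {d. primepow d} \<longrightarrow>
     K \<ge> 1 \<longrightarrow> Q > 0 \<longrightarrow> Q \<le> real N \<longrightarrow> K * sqrt (real N * ln (real N)) \<le> Q \<longrightarrow>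
     K * Q0 \<le> sqrt (real N) \<longrightarrow>
     minor_arc_integral (\<lambda>n. of_nat (divisor_count D n)) N K Q0 Q
       \<ge> c1 / K * (Q * (ln (ln (real N)))\<^sup>2)) sequentially"
    using minor_arc_integral_ge_near_zero by blast
  \<comment> \<open>All demands on N in one predicate free of K, so that \<open>N0\<close> is chosen
    before K.\<close>
  define good where "good N \<longleftrightarrow> (\<forall>D K Q Q0. {q. prime q} \<subseteq> D \<longrightarrow> D \<subseteq> {d. primepow d} \<longrightarrow>
     K \<ge> 1 \<longrightarrow> Q > 0 \<longrightarrow> Q \<le> real N \<longrightarrow> K * sqrt (real N * ln (real N)) \<le> Q \<longrightarrow>
     K * Q0 \<le> sqrt (real N) \<longrightarrow>
     minor_arc_integral (\<lambda>n. of_nat (divisor_count D n)) N K Q0 Q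
       \<ge> c1 / K * (Q * (ln (ln (real N)))\<^sup>2)) \<and>
     (\<forall>D P K Q Q0. {q. prime q} \<subseteq> D \<longrightarrow> D \<subseteq> {d. primepow d} \<longrightarrow>
     K > 0 \<longrightarrow> Q > 0 \<longrightarrow> Q0 \<ge> 0 \<longrightarrow> finite P \<longrightarrow>
     (\<forall>p\<in>P. prime p \<and> 1000 \<le> p \<and> real p \<le> sqrt (real N) \<and> 100 * K * real N / Q < real p \<and>
        real p * (K * Q0 / real N + K / Q) < 1) \<longrightarrow>
     minor_arc_integral (\<lambda>n. of_nat (divisor_count D n)) N K Q0 Q \<ge> real N / 10000 * sum_inv P) \<and>
     ln (real N) \<ge> 100 \<and> Y \<le> real N powr (1/2 - \<delta>/2) \<and>
     real N powr (1/2 - \<delta>/4) * (2 / sqrt (real N)) < 1" for N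
  have "eventually (\<lambda>N. ln (real N) \<ge> 100) sequentially" by real_asymp
  moreover have "eventually (\<lambda>N. Y \<le> real N powr (1/2 - \<delta>/2)) sequentially"
    using \<delta> by real_asymp
  moreover have "eventually (\<lambda>N. real N powr (1/2 - \<delta>/4) * (2 / sqrt (real N)) < 1) sequentially"
    using \<delta> by real_asymp
  ultimately have "eventually good sequentially"
    using c1(2) minor_arc_integral_ge_near_fractions unfolding good_def
    by (intro eventually_conj)
  then obtain N0 where N0: "\<And>N. N \<ge> N0 \<Longrightarrow> good N" unfolding eventually_sequentially by blast
  have "\<exists>\<kappa>>0. \<forall>N Q Q0 D.
    {q. prime q} \<subseteq> D \<longrightarrow> D \<subseteq> {d. primepow d} \<longrightarrow> N \<ge> N0 \<longrightarrow> Q \<le> real N \<longrightarrow>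
    K * sqrt (real N * ln (real N)) \<le> Q \<longrightarrow> real N * ln (real N) / Q \<le> Q0 \<longrightarrow>
    K * Q0 < real N powr (1/2 - \<delta>/2) \<longrightarrow>
    minor_arc_integral (\<lambda>n. of_nat (divisor_count D n)) N K Q0 Q
      \<ge> \<kappa> * (Q * (ln (ln (real N)))\<^sup>2 + real N * ln (ln (real N) / ln (2 * real N / Q)))"
    if K: "K \<ge> 10" for K
  proof -
    define C where "C = 1 + (ln (100 * K) + ln Y) / ln 2"
    define A where "A = 1 + ln (4 * C) / ln (1 + \<epsilon>)"
    \<comment> \<open>The final 1/2 pays for using the same integral twice, once for each
      term.\<close>
    define \<kappa> where "\<kappa> = min (c1 / K) (c3 / (10000 * A)) / 2"
    have lnK: "ln (100 * K) > 0" "ln Y > 0" using K c3 by auto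
    hence C: "C \<ge> 1" by (simp add: C_def)
    have A: "A \<ge> 1" using C \<epsilon> by (simp add: A_def)
    have \<kappa>: "\<kappa> > 0" using c1 c3 K A by (simp add: \<kappa>_def)
    have "minor_arc_integral (\<lambda>n. of_nat (divisor_count D n)) N K Q0 Q
      \<ge> \<kappa> * (Q * (ln (ln (real N)))\<^sup>2 + real N * ln (ln (real N) / ln (2 * real N / Q)))"
      if D: "{q. prime q} \<subseteq> D" "D \<subseteq> {d. primepow d}" and N: "N \<ge> N0"
        and Q: "Q \<le> real N" "K * sqrt (real N * ln (real N)) \<le> Q"
        and Q0: "real N * ln (real N) / Q \<le> Q0" "K * Q0 < real N powr (1/2 - \<delta>/2)" for N Q Q0 D
    proof -
      let ?I = "minor_arc_integral (\<lambda>n. of_nat (divisor_count D n)) N K Q0 Q"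
      note good = N0[OF N, unfolded good_def]
      have lnN: "ln (real N) \<ge> 100" using good by blast
      have N1: "real N > 1" using lnN by (cases "N \<le> 1") (auto simp: le_Suc_eq)
      have "sqrt (real N) * 1 \<le> sqrt (real N) * sqrt (ln (real N))"
        using lnN by (intro mult_left_mono) auto
      hence "K * sqrt (real N) \<le> K * sqrt (real N * ln (real N))"
        using K by (simp add: real_sqrt_mult)
      hence KQ: "K * sqrt (real N) \<le> Q" using Q by linarith
      have "K * sqrt (real N) > 0" using K N1 by (intro mult_pos_pos) auto
      hence Qpos: "Q > 0" using KQ by linarith
      have Q0pos: "Q0 \<ge> 0"
      proof -
        have "0 \<le> real N * ln (real N) / Q" using Qpos lnN by simp
        thus ?thesis using Q0 by linarith
      qed
      have "real N powr (1/2 - \<delta>/2) \<le> real N powr (1/2)" using N1 \<delta> by (intro powr_mono) auto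
      hence KQ0: "K * Q0 \<le> sqrt (real N)" using Q0 by (simp add: powr_half_sqrt)
      have first: "?I \<ge> c1 / K * (Q * (ln (ln (real N)))\<^sup>2)"
        using good D K Qpos Q KQ0 by simp
      define x where "x = real N powr (1/2 - \<delta>/4)"
      define y where "y = max Y (100 * K * real N / Q)"
      define r where "r = real N / Q"
      have r1: "r \<ge> 1" using Q Qpos by (simp add: r_def)
      have y_le: "y \<le> real N powr (1/2 - \<delta>/2)"
      proof -
        have "100 * K * real N / Q \<le> K * (real N * ln (real N) / Q)"
        proof -
          have "K * (real N / Q) * 100 \<le> K * (real N / Q) * ln (real N)"
            using lnN K Qpos by (intro mult_left_mono) auto
          thus ?thesis by (simp add: mult_ac)
        qed
        also have "\<dots> \<le> K * Q0" using Q0 K by (intro mult_left_mono) auto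
        finally show ?thesis using Q0 good by (simp add: y_def)
      qed
      have y1: "y > 1" using c3 by (simp add: y_def)
      \<comment> \<open>K \<ge> 10 ensures that every prime in the range is at least 1000, as the
        estimate near fractions requires.\<close>
      have "1000 * 1 \<le> 100 * K * r" using K r1 by (intro mult_mono) auto
      hence y1000: "y \<ge> 1000" by (simp add: y_def r_def)
      have lnx: "ln x = (1/2 - \<delta>/4) * ln (real N)" using N1 by (simp add: x_def ln_powr)
      have "ln y \<le> ln (real N powr (1/2 - \<delta>/2))" using y_le y1 by (intro ln_mono) auto
      hence "ln y \<le> (1/2 - \<delta>/2) * ln (real N)" using N1 by (simp add: ln_powr)
      hence "ln y * (1 + \<epsilon>) \<le> (1/2 - \<delta>/2) * ln (real N) * (1 + \<epsilon>)"
        using \<epsilon> by (intro mult_right_mono) auto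
      also have "\<dots> = ((1/2 - \<delta>/2) * (1 + \<epsilon>)) * ln (real N)" by simp
      also have "\<dots> \<le> (1/2 - \<delta>/4) * ln (real N)"
      proof (rule mult_right_mono)
        have "(1/2 - \<delta>/2) * (1 + \<epsilon>) = 1/2 - \<delta>/2 + \<delta>/8 - \<delta>\<^sup>2 / 8"
          by (simp add: \<epsilon>_def field_simps power2_eq_square)
        thus "(1/2 - \<delta>/2) * (1 + \<epsilon>) \<le> 1/2 - \<delta>/4"
          using \<delta> zero_le_power2[of \<delta>] by linarith
      qed (use lnN in simp)
      finally have lny: "ln y * (1 + \<epsilon>) \<le> (1/2 - \<delta>/4) * ln (real N)" .
      have "exp ((1 + \<epsilon>) * ln y) \<le> exp (ln x)" using lny lnx by (simp add: mult.commute)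
      hence yx: "x \<ge> y powr (1 + \<epsilon>)" using y1 N1 by (simp add: powr_def x_def)
      \<comment> \<open>For the last condition: K Q0 / N and K / Q are at most 1/sqrt N each, and p
        \<le> x is below sqrt N by a power of N.\<close>
      have P: "prime p \<and> 1000 \<le> p \<and> real p \<le> sqrt (real N) \<and> 100 * K * real N / Q < real p \<and>
        real p * (K * Q0 / real N + K / Q) < 1" if "p \<in> primes_between y x" for p
      proof -
        from that have p: "prime p" "y < real p" "real p \<le> x" by (auto simp: primes_between_def)
        have "x \<le> real N powr (1/2)" unfolding x_def using N1 \<delta> by (intro powr_mono) auto
        hence xs: "x \<le> sqrt (real N)" by (simp add: powr_half_sqrt)
        have "K * Q0 / real N \<le> sqrt (real N) / real N" using KQ0 by (intro divide_right_mono) auto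
        also have "\<dots> = 1 / sqrt (real N)" using N1 by (simp add: real_div_sqrt field_simps)
        finally have "K * Q0 / real N \<le> 1 / sqrt (real N)" .
        moreover have "K / Q \<le> 1 / sqrt (real N)" using KQ N1 Qpos by (simp add: field_simps)
        ultimately have "K * Q0 / real N + K / Q \<le> 2 / sqrt (real N)" by simp
        hence "real p * (K * Q0 / real N + K / Q) \<le> x * (2 / sqrt (real N))"
          using p K Q0pos Qpos by (intro mult_mono) auto
        also have "\<dots> < 1" using good by (simp add: x_def)
        finally show ?thesis using p xs y1000 by (auto simp: y_def)
      qed
      have "real N / 10000 * sum_inv (primes_between y x) \<le> ?I"
      proof -
        have imp: "\<forall>P. finite P \<longrightarrow> (\<forall>p\<in>P. prime p \<and> 1000 \<le> p \<and> real p \<le> sqrt (real N) \<and>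
            100 * K * real N / Q < real p \<and> real p * (K * Q0 / real N + K / Q) < 1) \<longrightarrow>
            ?I \<ge> real N / 10000 * sum_inv P"
          using good D K Qpos Q0pos by simp
        show ?thesis
          by (rule imp[THEN spec, THEN mp, OF finite_primes_between, THEN mp]) (intro ballI P)
      qed
      moreover have "sum_inv (primes_between y x) \<ge> c3 * ln (ln x / ln y)"
        using yx by (intro c3) (auto simp: y_def)
      hence "real N / 10000 * sum_inv (primes_between y x) \<ge> real N / 10000 * (c3 * ln (ln x / ln y))"
        by (intro mult_left_mono) auto
      ultimately have second: "?I \<ge> real N / 10000 * (c3 * ln (ln x / ln y))" by linarith
      define R where "R = ln (ln x / ln y)"
      define G where "G = ln (ln (real N) / ln (2 * real N / Q))"
      have lny2: "ln y \<le> C * ln (2 * r)"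
        unfolding C_def
      proof (rule ln_ratio_le[OF c3(2) _ r1 y1])
        have "100 * K * real N / Q = 100 * K / 2 * (2 * r)" by (simp add: r_def)
        moreover have "y = Y \<or> y = 100 * K * real N / Q" unfolding y_def by linarith
        ultimately show "y = Y \<or> y = 100 * K / 2 * (2 * r)" by metis
        show "100 * K \<ge> 2" using K by simp
      qed
      have "ln (ln (real N) / ln (2 * r)) \<le> (1 + ln (4 * C) / ln (1 + \<epsilon>)) * ln ((1/2 - \<delta>/4) * ln (real N) / ln y)"
      proof (rule ln_ln_ratio_le[OF \<epsilon> _ C _ _ _ lny lny2])
        show "1 / 4 \<le> 1 / 2 - \<delta> / 4" using \<delta> by simp
        show "ln (real N) > 0" using lnN by linarith
        show "ln y > 0" using y1 by simp
        show "ln (2 * r) > 0" using r1 by (intro ln_gt_zero) simp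
      qed
      hence "ln (ln (real N) / ln (2 * r)) \<le> A * ln (ln x / ln y)" by (simp only: A_def lnx)
      hence GR: "G \<le> A * R" by (simp add: G_def R_def r_def)
      have R0: "R \<ge> 0"
      proof -
        have "ln y * 1 \<le> ln y * (1 + \<epsilon>)" using y1 \<epsilon> by (intro mult_left_mono) auto
        hence "ln y \<le> ln x" using lny lnx by linarith
        thus ?thesis using y1 by (simp add: R_def)
      qed
      have "2 * \<kappa> * (Q * (ln (ln (real N)))\<^sup>2) \<le> c1 / K * (Q * (ln (ln (real N)))\<^sup>2)"
        using Qpos by (intro mult_right_mono) (auto simp: \<kappa>_def)
      moreover have "2 * \<kappa> * (real N * G) \<le> real N / 10000 * (c3 * R)"
      proof -
        have "2 * \<kappa> * (real N * G) \<le> 2 * \<kappa> * (real N * (A * R))"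
          using GR \<kappa> by (intro mult_left_mono) auto
        also have "\<dots> \<le> c3 / (10000 * A) * (real N * (A * R))"
          using A R0 by (intro mult_right_mono) (auto simp: \<kappa>_def)
        also have "\<dots> = real N / 10000 * (c3 * R)" using A by simp
        finally show ?thesis .
      qed
      ultimately have "2 * (\<kappa> * (Q * (ln (ln (real N)))\<^sup>2 + real N * G)) \<le> ?I + ?I"
        using first second unfolding R_def by (simp add: algebra_simps)
      thus ?thesis by (simp add: G_def)
    qed
    thus ?thesis using \<kappa> by blast
  qed
  thus ?thesis using that by blast
qed

text \<open>\<open>exp_sum\<close> starts at n = 1, so identities valid for n \<ge> 1
  suffice.\<close>

lemma minor_arc_integral_cong:
  assumes "\<And>n. n \<ge> 1 \<Longrightarrow> f n = g n"
  shows "minor_arc_integral f N K Q0 Q = minor_arc_integral g N K Q0 Q"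
proof -
  have "exp_sum f N = exp_sum g N"
    unfolding exp_sum_def by (intro ext sum.cong) (auto simp: assms)
  thus ?thesis by (simp add: minor_arc_integral_def)
qed

text \<open>The two extreme choices of \<open>D\<close>, primes and prime powers, give
  \<open>omega\<close> and \<open>Omega\<close>. The order of quantifiers makes \<open>N0\<close>
  depend on \<delta> only, while \<kappa> may depend on \<delta> and K.\<close>

theorem proposition3p2:
  "\<exists>K0::real. K0 > 0 \<and> (\<exists>\<delta>0::real. \<delta>0 > 0 \<and>
     (\<forall>\<delta>::real. 0 < \<delta> \<and> \<delta> < \<delta>0 \<longrightarrow>
       (\<exists>N0::nat. \<forall>K::real. K \<ge> K0 \<longrightarrow>
         (\<exists>\<kappa>::real. \<kappa> > 0 \<and>
           (\<forall>N::nat. \<forall>Q Q0 :: real.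
              N \<ge> N0 \<and>
              real N powr (1/2 + \<delta>) \<le> Q \<and> Q \<le> real N \<and>
              K * sqrt (real N * ln (real N)) \<le> Q \<and>
              real N * ln (real N) / Q \<le> Q0 \<and> Q0 \<le> Q / K\<^sup>2 \<and>
              K * Q0 < real N powr (1/2 - \<delta>/2) \<longrightarrow>
              (\<forall>\<omega>' \<in> {omega, Omega}.
                 minor_arc_integral (\<lambda>n. of_nat (\<omega>' n)) N K Q0 Q \<ge>
                   \<kappa> * (Q * (ln (ln (real N)))\<^sup>2
                        + real N * ln (ln (real N) / ln (2 * real N / Q)))))))))"
proof (rule exI[of _ 10], intro conjI exI[of _ "1 / 2"] allI impI)
  fix \<delta> :: real assume "0 < \<delta> \<and> \<delta> < 1 / 2"
  then obtain N0 :: nat where N0: "\<And>K. K \<ge> 10 \<Longrightarrow> \<exists>\<kappa>>0. \<forall>N Q Q0 D.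
    {q. prime q} \<subseteq> D \<longrightarrow> D \<subseteq> {d. primepow d} \<longrightarrow> N \<ge> N0 \<longrightarrow> Q \<le> real N \<longrightarrow>
    K * sqrt (real N * ln (real N)) \<le> Q \<longrightarrow> real N * ln (real N) / Q \<le> Q0 \<longrightarrow>
    K * Q0 < real N powr (1/2 - \<delta>/2) \<longrightarrow>
    minor_arc_integral (\<lambda>n. of_nat (divisor_count D n)) N K Q0 Q
      \<ge> \<kappa> * (Q * (ln (ln (real N)))\<^sup>2 + real N * ln (ln (real N) / ln (2 * real N / Q)))"
    using minor_arc_integral_divisor_count_ge[of \<delta>] by blast
  have eq: "minor_arc_integral (\<lambda>n. of_nat (omega n)) N K Q0 Q
      = minor_arc_integral (\<lambda>n. of_nat (divisor_count {p. prime p} n)) N K Q0 Q"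
    "minor_arc_integral (\<lambda>n. of_nat (Omega n)) N K Q0 Q
      = minor_arc_integral (\<lambda>n. of_nat (divisor_count {d. primepow d} n)) N K Q0 Q" for N K Q0 Q
    by (intro minor_arc_integral_cong; simp add: omega_conv_divisor_count Omega_conv_divisor_count)+
  have sub: "{p::nat. prime p} \<subseteq> {d. primepow d}" by auto
  show "\<exists>N0::nat. \<forall>K::real. K \<ge> 10 \<longrightarrow>
         (\<exists>\<kappa>::real. \<kappa> > 0 \<and>
           (\<forall>N::nat. \<forall>Q Q0 :: real.
              N \<ge> N0 \<and>
              real N powr (1/2 + \<delta>) \<le> Q \<and> Q \<le> real N \<and>
              K * sqrt (real N * ln (real N)) \<le> Q \<and>
              real N * ln (real N) / Q \<le> Q0 \<and> Q0 \<le> Q / K\<^sup>2 \<and>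
              K * Q0 < real N powr (1/2 - \<delta>/2) \<longrightarrow>
              (\<forall>\<omega>' \<in> {omega, Omega}.
                 minor_arc_integral (\<lambda>n. of_nat (\<omega>' n)) N K Q0 Q \<ge>
                   \<kappa> * (Q * (ln (ln (real N)))\<^sup>2
                        + real N * ln (ln (real N) / ln (2 * real N / Q))))))"
  proof (intro exI[of _ N0] allI impI)
    fix K :: real assume "K \<ge> 10"
    from N0[OF this] obtain \<kappa> where \<kappa>: "\<kappa> > 0" "\<forall>N Q Q0 D.
      {q. prime q} \<subseteq> D \<longrightarrow> D \<subseteq> {d. primepow d} \<longrightarrow> N \<ge> N0 \<longrightarrow> Q \<le> real N \<longrightarrow>
      K * sqrt (real N * ln (real N)) \<le> Q \<longrightarrow> real N * ln (real N) / Q \<le> Q0 \<longrightarrow>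
      K * Q0 < real N powr (1/2 - \<delta>/2) \<longrightarrow>
      minor_arc_integral (\<lambda>n. of_nat (divisor_count D n)) N K Q0 Q
        \<ge> \<kappa> * (Q * (ln (ln (real N)))\<^sup>2 + real N * ln (ln (real N) / ln (2 * real N / Q)))"
      by blast
    show "\<exists>\<kappa>::real. \<kappa> > 0 \<and>
           (\<forall>N::nat. \<forall>Q Q0 :: real.
              N \<ge> N0 \<and>
              real N powr (1/2 + \<delta>) \<le> Q \<and> Q \<le> real N \<and>
              K * sqrt (real N * ln (real N)) \<le> Q \<and>
              real N * ln (real N) / Q \<le> Q0 \<and> Q0 \<le> Q / K\<^sup>2 \<and>
              K * Q0 < real N powr (1/2 - \<delta>/2) \<longrightarrow>
              (\<forall>\<omega>' \<in> {omega, Omega}.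
                 minor_arc_integral (\<lambda>n. of_nat (\<omega>' n)) N K Q0 Q \<ge>
                   \<kappa> * (Q * (ln (ln (real N)))\<^sup>2
                        + real N * ln (ln (real N) / ln (2 * real N / Q)))))"
      by (intro exI[of _ \<kappa>] conjI \<kappa>(1) allI impI ballI) (use \<kappa>(2) sub in \<open>auto simp: eq\<close>)
  qed
qed auto

end
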